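(* Let $V$ be a finite-dimensional irreducible $\boxtimes$-module over $\mathbb F$. For a nonidentity $\sigma\in G$ there exists a nonzero bilinear form $\langle\,,\rangle_\sigma$ on $V$ such that $$\langle\xi.u,v\rangle_\sigma=-\langle u,\sigma(\xi).v\rangle_\sigma\qquad\text{for all }\xi\in\boxtimes,\ u,v\in V.$$ This form is unique up to multiplication by a nonzero scalar in $\mathbb F$. The form is nondegenerate. The form is symmetric.
   Context: $\mathbb F$ is an algebraically closed field of characteristic $0$, and $\mathbb I=\{0,1,2,3\}$. The tetrahedron algebra $\boxtimes$ is the Lie algebra over $\mathbb F$ with generators $\{x_{ij}\mid i,j\in\mathbb I,\ i\ne j\}$ and relations: (i) $x_{ij}+x_{ji}=0$ for distinct $i,j$; (ii) $[x_{ij},x_{jk}]=2x_{ij}+2x_{jk}$ for mutually distinct $i,j,k$; (iii) $[x_{ij},[x_{ij},[x_{ij},x_{k\ell}]]]=4[x_{ij},x_{k\ell}]$ for mutually distinct $i,j,k,\ell$. $S_4$ is the group of permutations of $\mathbb I$. It acts on $\boxtimes$ by Lie algebra automorphisms with $\sigma(x_{ij})=x_{\sigma(i),\sigma(j)}$. $G$ is the subgroup of $S_4$ consisting of the identity and $(01)(23)$, $(02)(13)$, $(03)(12)$. *)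

theory Defs
  imports
    "HOL-Computational_Algebra.Polynomial"
    "HOL-Library.Numeral_Type"
    "HOL-Combinatorics.Perm"
begin

section \<open>Lie algebras and their modules\<close>

locale lie_algebra = vector_space scale
  for scale :: "'f::field \<Rightarrow> 'a::ab_group_add \<Rightarrow> 'a" +
  fixes bracket :: "'a \<Rightarrow> 'a \<Rightarrow> 'a"
  assumes bracket_add_left: "bracket (x + y) z = bracket x z + bracket y z"
    and bracket_add_right: "bracket x (y + z) = bracket x y + bracket x z"
    and bracket_scale_left: "bracket (scale c x) y = scale c (bracket x y)"
    and bracket_scale_right: "bracket x (scale c y) = scale c (bracket x y)"
    and bracket_self: "bracket x x = 0"
    and jacobi: "bracket x (bracket y z) + bracket y (bracket z x) + bracket z (bracket x y) = 0"

locale lie_algebra_hom =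
  A: lie_algebra scaleA bracketA + B: lie_algebra scaleB bracketB +
  Vector_Spaces.linear scaleA scaleB h
  for scaleA :: "'f::field \<Rightarrow> 'a::ab_group_add \<Rightarrow> 'a" and bracketA
    and scaleB :: "'f \<Rightarrow> 'b::ab_group_add \<Rightarrow> 'b" and bracketB
    and h :: "'a \<Rightarrow> 'b" +
  assumes hom_bracket: "h (bracketA x y) = bracketB (h x) (h y)"

locale lie_module = L: lie_algebra scaleL bracket + vector_space scale
  for scaleL :: "'f::field \<Rightarrow> 'a::ab_group_add \<Rightarrow> 'a" and bracket
    and scale :: "'f \<Rightarrow> 'v::ab_group_add \<Rightarrow> 'v" +
  fixes act :: "'a \<Rightarrow> 'v \<Rightarrow> 'v"
  assumes act_add_left: "act (x + y) v = act x v + act y v"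
    and act_scale_left: "act (scaleL c x) v = scale c (act x v)"
    and act_add_right: "act x (v + w) = act x v + act x w"
    and act_scale_right: "act x (scale c v) = scale c (act x v)"
    and act_bracket: "act (bracket x y) v = act x (act y v) - act y (act x v)"
begin

definition submodule :: "'v set \<Rightarrow> bool"
  where "submodule W \<longleftrightarrow> subspace W \<and> (\<forall>x. \<forall>w\<in>W. act x w \<in> W)"

definition irreducible_module :: bool
  where "irreducible_module \<longleftrightarrow>
    (\<exists>v::'v. v \<noteq> 0) \<and> (\<forall>W. submodule W \<longrightarrow> W = {0} \<or> W = UNIV)"

definition finite_dimensional_module :: bool
  where "finite_dimensional_module \<longleftrightarrow> (\<exists>B. finite B \<and> span B = UNIV)"

end


section \<open>Bilinear forms\<close>

definition bilinear_form ::
    "('f::field \<Rightarrow> 'v::ab_group_add \<Rightarrow> 'v) \<Rightarrow> ('v \<Rightarrow> 'v \<Rightarrow> 'f) \<Rightarrow> bool"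
  where "bilinear_form scale b \<longleftrightarrow>
    (\<forall>v. Vector_Spaces.linear scale (*) (\<lambda>u. b u v)) \<and>
    (\<forall>u. Vector_Spaces.linear scale (*) (\<lambda>v. b u v))"

definition nondegenerate_form :: "('v::zero \<Rightarrow> 'v \<Rightarrow> 'f::zero) \<Rightarrow> bool"
  where "nondegenerate_form b \<longleftrightarrow>
    (\<forall>u. (\<forall>v. b u v = 0) \<longrightarrow> u = 0) \<and> (\<forall>v. (\<forall>u. b u v = 0) \<longrightarrow> v = 0)"

definition symmetric_form :: "('v \<Rightarrow> 'v \<Rightarrow> 'f) \<Rightarrow> bool"
  where "symmetric_form b \<longleftrightarrow> (\<forall>u v. b u v = b v u)"


section \<open>Lie algebras given by generators and relations\<close>

datatype ('f, 'g) lie_term =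
    Gen 'g
  | Zero
  | Plus "('f, 'g) lie_term" "('f, 'g) lie_term"
  | Scale 'f "('f, 'g) lie_term"
  | Bracket "('f, 'g) lie_term" "('f, 'g) lie_term"

text \<open>
  The least congruence on formal expressions that contains the relation \<open>R\<close> and the axioms of a
  Lie algebra over \<open>'f\<close>. The quotient by it is the Lie algebra with generators \<open>'g\<close> and
  relations \<open>R\<close>.
\<close>

inductive lie_cong ::
    "(('f::field, 'g) lie_term \<Rightarrow> ('f, 'g) lie_term \<Rightarrow> bool) \<Rightarrow>
     ('f, 'g) lie_term \<Rightarrow> ('f, 'g) lie_term \<Rightarrow> bool"
  for R
  where
    rel: "R s t \<Longrightarrow> lie_cong R s t"
  | refl: "lie_cong R t t"
  | sym: "lie_cong R s t \<Longrightarrow> lie_cong R t s"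
  | trans: "lie_cong R s t \<Longrightarrow> lie_cong R t u \<Longrightarrow> lie_cong R s u"
  | cong_plus: "lie_cong R s s' \<Longrightarrow> lie_cong R t t' \<Longrightarrow> lie_cong R (Plus s t) (Plus s' t')"
  | cong_scale: "lie_cong R t t' \<Longrightarrow> lie_cong R (Scale c t) (Scale c t')"
  | cong_bracket:
      "lie_cong R s s' \<Longrightarrow> lie_cong R t t' \<Longrightarrow> lie_cong R (Bracket s t) (Bracket s' t')"
  | plus_assoc: "lie_cong R (Plus (Plus s t) u) (Plus s (Plus t u))"
  | plus_comm: "lie_cong R (Plus s t) (Plus t s)"
  | plus_zero: "lie_cong R (Plus Zero t) t"
  | plus_inverse: "lie_cong R (Plus (Scale (-1) t) t) Zero"
  | scale_plus: "lie_cong R (Scale c (Plus s t)) (Plus (Scale c s) (Scale c t))"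
  | scale_add: "lie_cong R (Scale (c + d) t) (Plus (Scale c t) (Scale d t))"
  | scale_scale: "lie_cong R (Scale c (Scale d t)) (Scale (c * d) t)"
  | scale_one: "lie_cong R (Scale 1 t) t"
  | bracket_plus_left: "lie_cong R (Bracket (Plus s t) u) (Plus (Bracket s u) (Bracket t u))"
  | bracket_plus_right: "lie_cong R (Bracket s (Plus t u)) (Plus (Bracket s t) (Bracket s u))"
  | bracket_scale_left: "lie_cong R (Bracket (Scale c s) t) (Scale c (Bracket s t))"
  | bracket_scale_right: "lie_cong R (Bracket s (Scale c t)) (Scale c (Bracket s t))"
  | bracket_self: "lie_cong R (Bracket t t) Zero"
  | jacobi: "lie_cong R
      (Plus (Plus (Bracket s (Bracket t u)) (Bracket t (Bracket u s))) (Bracket u (Bracket s t)))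
      Zero"

lemma equivp_lie_cong: "equivp (lie_cong R)"
  by (intro equivpI reflpI sympI transpI) (fact lie_cong.refl, fact lie_cong.sym, fact lie_cong.trans)


section \<open>The tetrahedron algebra\<close>

text \<open>
  The index set is the four-element type \<^typ>\<open>4\<close>, with elements 0, 1, 2, 3 (so 4 = 0 there).
\<close>

typedef arc = "{(i, j). i \<noteq> j} :: (4 \<times> 4) set"
  by (rule exI[of _ "(0, 1)"]) simp

setup_lifting type_definition_arc

text \<open>For \<open>i = j\<close> the values of \<open>arc i j\<close>, \<open>X i j\<close> and \<open>tet_gen i j\<close> are irrelevant.\<close>

definition arc :: "4 \<Rightarrow> 4 \<Rightarrow> arc"
  where "arc i j = Abs_arc (i, j)"

abbreviation X :: "4 \<Rightarrow> 4 \<Rightarrow> ('f, arc) lie_term"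
  where "X i j \<equiv> Gen (arc i j)"

inductive tet_rel :: "('f::field, arc) lie_term \<Rightarrow> ('f, arc) lie_term \<Rightarrow> bool"
  where
    skew: "i \<noteq> j \<Longrightarrow> tet_rel (Plus (X i j) (X j i)) Zero"
  | triangle: "distinct [i, j, k] \<Longrightarrow>
      tet_rel (Bracket (X i j) (X j k)) (Plus (Scale 2 (X i j)) (Scale 2 (X j k)))"
  | dolan_grady: "distinct [i, j, k, l] \<Longrightarrow>
      tet_rel (Bracket (X i j) (Bracket (X i j) (Bracket (X i j) (X k l))))
              (Scale 4 (Bracket (X i j) (X k l)))"

quotient_type (overloaded) 'f tetrahedron_algebra =
    "('f::field, arc) lie_term" / "lie_cong tet_rel"
  by (rule equivp_lie_cong)

lift_definition tet_gen :: "4 \<Rightarrow> 4 \<Rightarrow> 'f::field tetrahedron_algebra"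
  is "\<lambda>i j. X i j" .

lift_definition tet_scale ::
    "'f::field \<Rightarrow> 'f tetrahedron_algebra \<Rightarrow> 'f tetrahedron_algebra"
  is Scale by (rule lie_cong.cong_scale)

lift_definition tet_bracket ::
    "'f::field tetrahedron_algebra \<Rightarrow> 'f tetrahedron_algebra \<Rightarrow> 'f tetrahedron_algebra"
  is Bracket by (rule lie_cong.cong_bracket)

instantiation tetrahedron_algebra :: (field) ab_group_add
begin

lift_definition zero_tetrahedron_algebra :: "'a tetrahedron_algebra" is Zero .

lift_definition plus_tetrahedron_algebra ::
    "'a tetrahedron_algebra \<Rightarrow> 'a tetrahedron_algebra \<Rightarrow> 'a tetrahedron_algebra"
  is Plus by (rule lie_cong.cong_plus)

lift_definition uminus_tetrahedron_algebra :: "'a tetrahedron_algebra \<Rightarrow> 'a tetrahedron_algebra"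
  is "Scale (-1)" by (rule lie_cong.cong_scale)

definition minus_tetrahedron_algebra ::
    "'a tetrahedron_algebra \<Rightarrow> 'a tetrahedron_algebra \<Rightarrow> 'a tetrahedron_algebra"
  where "minus_tetrahedron_algebra x y = x + - y"

instance
proof
  fix a b c :: "'a tetrahedron_algebra"
  show "a + b + c = a + (b + c)" by transfer (rule lie_cong.plus_assoc)
  show "a + b = b + a" by transfer (rule lie_cong.plus_comm)
  show "0 + a = a" by transfer (rule lie_cong.plus_zero)
  show "- a + a = 0" by transfer (rule lie_cong.plus_inverse)
  show "a - b = a + - b" by (rule minus_tetrahedron_algebra_def)
qed

end

interpretation tet: lie_algebra tet_scale tet_bracket
proof
  fix x y z :: "'a::field tetrahedron_algebra" and c d :: 'a
  show "tet_scale c (x + y) = tet_scale c x + tet_scale c y"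
    by transfer (rule lie_cong.scale_plus)
  show "tet_scale (c + d) x = tet_scale c x + tet_scale d x"
    by transfer (rule lie_cong.scale_add)
  show "tet_scale c (tet_scale d x) = tet_scale (c * d) x"
    by transfer (rule lie_cong.scale_scale)
  show "tet_scale 1 x = x"
    by transfer (rule lie_cong.scale_one)
  show "tet_bracket (x + y) z = tet_bracket x z + tet_bracket y z"
    by transfer (rule lie_cong.bracket_plus_left)
  show "tet_bracket x (y + z) = tet_bracket x y + tet_bracket x z"
    by transfer (rule lie_cong.bracket_plus_right)
  show "tet_bracket (tet_scale c x) y = tet_scale c (tet_bracket x y)"
    by transfer (rule lie_cong.bracket_scale_left)
  show "tet_bracket x (tet_scale c y) = tet_scale c (tet_bracket x y)"
    by transfer (rule lie_cong.bracket_scale_right)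
  show "tet_bracket x x = 0"
    by transfer (rule lie_cong.bracket_self)
  show "tet_bracket x (tet_bracket y z) + tet_bracket y (tet_bracket z x)
      + tet_bracket z (tet_bracket x y) = 0"
    by transfer (rule lie_cong.jacobi)
qed

lemma tet_gen_skew: "i \<noteq> j \<Longrightarrow> tet_gen i j + tet_gen j i = 0"
  by transfer (intro lie_cong.rel tet_rel.skew)

lemma tet_gen_triangle:
  "distinct [i, j, k] \<Longrightarrow>
    tet_bracket (tet_gen i j) (tet_gen j k) = tet_scale 2 (tet_gen i j) + tet_scale 2 (tet_gen j k)"
  by transfer (intro lie_cong.rel tet_rel.triangle)

lemma tet_gen_dolan_grady:
  "distinct [i, j, k, l] \<Longrightarrow>
    tet_bracket (tet_gen i j) (tet_bracket (tet_gen i j) (tet_bracket (tet_gen i j) (tet_gen k l)))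
      = tet_scale 4 (tet_bracket (tet_gen i j) (tet_gen k l))"
  by transfer (intro lie_cong.rel tet_rel.dolan_grady)

lemma arc_cases:
  obtains i j where "i \<noteq> j" "a = arc i j"
  by (cases a) (auto simp: arc_def)

lemma tet_induct [case_names gen zero plus scale bracket]:
  assumes "\<And>i j. i \<noteq> j \<Longrightarrow> P (tet_gen i j)"
    and "P 0"
    and "\<And>x y. P x \<Longrightarrow> P y \<Longrightarrow> P (x + y)"
    and "\<And>c x. P x \<Longrightarrow> P (tet_scale c x)"
    and "\<And>x y. P x \<Longrightarrow> P y \<Longrightarrow> P (tet_bracket x y)"
  shows "P x"
proof -
  have "P (abs_tetrahedron_algebra t)" for t
  proof (induction t)
    case (Gen a)
    obtain i j where "i \<noteq> j" "a = arc i j" by (rule arc_cases)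
    then show ?case using assms(1)[of i j] by (simp add: tet_gen.abs_eq)
  next
    case Zero
    then show ?case using assms(2) by (simp add: zero_tetrahedron_algebra.abs_eq)
  next
    case (Plus s t)
    then show ?case using assms(3) by (metis plus_tetrahedron_algebra.abs_eq)
  next
    case (Scale c t)
    then show ?case using assms(4) by (metis tet_scale.abs_eq)
  next
    case (Bracket s t)
    then show ?case using assms(5) by (metis tet_bracket.abs_eq)
  qed
  then show ?thesis by (metis Quotient3_abs_rep Quotient3_tetrahedron_algebra)
qed


subsection \<open>Universal property\<close>

primrec lie_eval ::
    "('f \<Rightarrow> 'b \<Rightarrow> 'b) \<Rightarrow> ('b \<Rightarrow> 'b \<Rightarrow> 'b) \<Rightarrow> ('g \<Rightarrow> 'b::ab_group_add) \<Rightarrow>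
     ('f, 'g) lie_term \<Rightarrow> 'b"
  where
    "lie_eval sc br y (Gen g) = y g"
  | "lie_eval sc br y Zero = 0"
  | "lie_eval sc br y (Plus s t) = lie_eval sc br y s + lie_eval sc br y t"
  | "lie_eval sc br y (Scale c t) = sc c (lie_eval sc br y t)"
  | "lie_eval sc br y (Bracket s t) = br (lie_eval sc br y s) (lie_eval sc br y t)"

lemma (in lie_algebra) lie_eval_cong:
  assumes "\<And>s t. R s t \<Longrightarrow> lie_eval scale bracket y s = lie_eval scale bracket y t"
    and "lie_cong R s t"
  shows "lie_eval scale bracket y s = lie_eval scale bracket y t"
  using assms(2)
  by induction
    (simp_all add: assms(1) bracket_add_left bracket_add_right bracket_scale_left
      bracket_scale_right bracket_self jacobi[unfolded add.assoc] scale_right_distrib scale_left_distrib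
      add.assoc)

lemma tet_universal_property:
  fixes sc :: "'f::field \<Rightarrow> 'b::ab_group_add \<Rightarrow> 'b"
  assumes "lie_algebra sc br"
    and skew: "\<And>i j. i \<noteq> j \<Longrightarrow> y i j + y j i = 0"
    and triangle: "\<And>i j k. distinct [i, j, k] \<Longrightarrow>
          br (y i j) (y j k) = sc 2 (y i j) + sc 2 (y j k)"
    and dolan_grady: "\<And>i j k l. distinct [i, j, k, l] \<Longrightarrow>
          br (y i j) (br (y i j) (br (y i j) (y k l))) = sc 4 (br (y i j) (y k l))"
  shows "\<exists>!h. lie_algebra_hom tet_scale tet_bracket sc br h \<and>
          (\<forall>i j. i \<noteq> j \<longrightarrow> h (tet_gen i j) = y i j)"
proof -
  interpret B: lie_algebra sc br by fact
  define z where "z = (\<lambda>a. case Rep_arc a of (i, j) \<Rightarrow> y i j)"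
  have z: "z (arc i j) = y i j" if "i \<noteq> j" for i j
    using that by (simp add: z_def arc_def Abs_arc_inverse)
  have rel: "lie_eval sc br z s = lie_eval sc br z t" if "tet_rel s t" for s t
    using that by cases (auto simp: z skew triangle dolan_grady eq_commute)
  have eval: "lie_eval sc br z s = lie_eval sc br z t" if "lie_cong tet_rel s t" for s t
    using B.lie_eval_cong[OF rel that] .
  define h where "h x = lie_eval sc br z (rep_tetrahedron_algebra x)" for x
  have h: "h (abs_tetrahedron_algebra t) = lie_eval sc br z t" for t
    unfolding h_def
    by (rule eval) (metis Quotient3_rep_abs Quotient3_tetrahedron_algebra lie_cong.refl)
  have ex: "\<exists>t. x = abs_tetrahedron_algebra t" for x :: "'f tetrahedron_algebra"
    by (metis Quotient3_abs_rep Quotient3_tetrahedron_algebra)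
  have hom: "lie_algebra_hom tet_scale tet_bracket sc br h"
  proof unfold_locales
    fix u v :: "'f tetrahedron_algebra" and c :: 'f
    obtain s t where st: "u = abs_tetrahedron_algebra s" "v = abs_tetrahedron_algebra t"
      using ex[of u] ex[of v] by blast
    show "h (u + v) = h u + h v"
      unfolding st plus_tetrahedron_algebra.abs_eq h by simp
    show "h (tet_scale c u) = sc c (h u)"
      unfolding st tet_scale.abs_eq h by simp
    show "h (tet_bracket u v) = br (h u) (h v)"
      unfolding st tet_bracket.abs_eq h by simp
  qed
  show ?thesis
  proof (intro ex1I[of _ h] conjI hom allI impI)
    fix i j :: 4 assume "i \<noteq> j"
    then show "h (tet_gen i j) = y i j" by (simp add: tet_gen.abs_eq h z)
  next
    fix k
    assume k: "lie_algebra_hom tet_scale tet_bracket sc br k \<and>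
      (\<forall>i j. i \<noteq> j \<longrightarrow> k (tet_gen i j) = y i j)"
    interpret h: lie_algebra_hom tet_scale tet_bracket sc br h by (rule hom)
    interpret k: lie_algebra_hom tet_scale tet_bracket sc br k using k by blast
    show "k = h"
    proof
      fix x show "k x = h x"
      proof (induction x rule: tet_induct)
        case (gen i j)
        then show ?case using k by (simp add: tet_gen.abs_eq h z)
      qed (simp_all add: h.zero k.zero h.add k.add h.scale k.scale h.hom_bracket k.hom_bracket)
    qed
  qed
qed


subsection \<open>The action of the symmetric group\<close>

lemma perm_apply_eq_iff: "Perm.apply \<sigma> i = Perm.apply \<sigma> j \<longleftrightarrow> i = j"
  by (rule inj_eq[OF bij_is_inj[OF bij_apply]])

lift_definition arc_perm :: "4 perm \<Rightarrow> arc \<Rightarrow> arc"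
  is "\<lambda>\<sigma> (i, j). (Perm.apply \<sigma> i, Perm.apply \<sigma> j)"
  by (auto simp: perm_apply_eq_iff)

lemma arc_perm_arc:
  "i \<noteq> j \<Longrightarrow> arc_perm \<sigma> (arc i j) = arc (Perm.apply \<sigma> i) (Perm.apply \<sigma> j)"
  unfolding arc_def
  by (subst arc_perm.abs_eq) (auto simp: eq_onp_def)

lemma tet_rel_perm:
  "tet_rel s t \<Longrightarrow>
    tet_rel (map_lie_term id (arc_perm \<sigma>) s) (map_lie_term id (arc_perm \<sigma>) t)"
  by (induction rule: tet_rel.induct) (auto simp: arc_perm_arc perm_apply_eq_iff intro!: tet_rel.intros)

lift_definition tet_perm ::
    "4 perm \<Rightarrow> 'f::field tetrahedron_algebra \<Rightarrow> 'f tetrahedron_algebra"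
  is "\<lambda>\<sigma>. map_lie_term id (arc_perm \<sigma>)"
proof -
  fix \<sigma> and s t :: "('f, arc) lie_term"
  assume "lie_cong tet_rel s t"
  then show "lie_cong tet_rel (map_lie_term id (arc_perm \<sigma>) s) (map_lie_term id (arc_perm \<sigma>) t)"
    by (induction rule: lie_cong.induct) (auto intro: lie_cong.intros tet_rel_perm[unfolded id_def] simp: id_def)
qed

lemma tet_perm_gen:
  "i \<noteq> j \<Longrightarrow> tet_perm \<sigma> (tet_gen i j) = tet_gen (Perm.apply \<sigma> i) (Perm.apply \<sigma> j)"
  by (simp add: tet_perm.abs_eq tet_gen.abs_eq arc_perm_arc)

lemma lie_algebra_hom_tet_perm:
  "lie_algebra_hom tet_scale tet_bracket tet_scale tet_bracket
    (tet_perm \<sigma> :: 'f::field tetrahedron_algebra \<Rightarrow> _)"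
proof unfold_locales
  fix x y :: "'f tetrahedron_algebra" and c :: 'f
  show "tet_perm \<sigma> (x + y) = tet_perm \<sigma> x + tet_perm \<sigma> y"
    by transfer (simp add: lie_cong.refl)
  show "tet_perm \<sigma> (tet_scale c x) = tet_scale c (tet_perm \<sigma> x)"
    by transfer (simp add: lie_cong.refl)
  show "tet_perm \<sigma> (tet_bracket x y) = tet_bracket (tet_perm \<sigma> x) (tet_perm \<sigma> y)"
    by transfer (simp add: lie_cong.refl)
qed

lemma tet_perm_one: "tet_perm 1 x = x"
proof -
  interpret lie_algebra_hom tet_scale tet_bracket tet_scale tet_bracket "tet_perm 1"
    by (rule lie_algebra_hom_tet_perm)
  show ?thesis
    by (induction x rule: tet_induct) (simp_all add: tet_perm_gen zero add scale hom_bracket)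
qed

lemma tet_perm_mult: "tet_perm (\<sigma> * \<tau>) x = tet_perm \<sigma> (tet_perm \<tau> x)"
proof -
  interpret a: lie_algebra_hom tet_scale tet_bracket tet_scale tet_bracket "tet_perm \<sigma>"
    by (rule lie_algebra_hom_tet_perm)
  interpret b: lie_algebra_hom tet_scale tet_bracket tet_scale tet_bracket "tet_perm \<tau>"
    by (rule lie_algebra_hom_tet_perm)
  interpret ab: lie_algebra_hom tet_scale tet_bracket tet_scale tet_bracket "tet_perm (\<sigma> * \<tau>)"
    by (rule lie_algebra_hom_tet_perm)
  show ?thesis
  proof (induction x rule: tet_induct)
    case (gen i j)
    then show ?case by (simp add: tet_perm_gen apply_times perm_apply_eq_iff)
  qed (simp_all add: a.zero b.zero ab.zero a.add b.add ab.add a.scale b.scale ab.scale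
      a.hom_bracket b.hom_bracket ab.hom_bracket)
qed

lemma bij_tet_perm: "bij (tet_perm \<sigma>)"
  by (rule o_bij[of "tet_perm (inverse \<sigma>)"])
    (simp_all add: fun_eq_iff tet_perm_one flip: tet_perm_mult)

definition klein_four :: "4 perm set"
  where "klein_four =
    {1,
     Perm.swap 0 1 * Perm.swap 2 3,
     Perm.swap 0 2 * Perm.swap 1 3,
     Perm.swap 0 3 * Perm.swap 1 2}"


section \<open>Twisted invariant forms\<close>

definition nonzero_twisted_form ::
    "4 perm \<Rightarrow> ('f::field \<Rightarrow> 'v::ab_group_add \<Rightarrow> 'v) \<Rightarrow>
     ('f tetrahedron_algebra \<Rightarrow> 'v \<Rightarrow> 'v) \<Rightarrow> ('v \<Rightarrow> 'v \<Rightarrow> 'f) \<Rightarrow> bool"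
  where "nonzero_twisted_form \<sigma> scale act b \<longleftrightarrow>
    bilinear_form scale b \<and> (\<exists>u v. b u v \<noteq> 0) \<and>
    (\<forall>\<xi> u v. b (act \<xi> u) v = - b u (act (tet_perm \<sigma> \<xi>) v))"

end

theory Submission
  imports Defs "HOL-Library.Function_Algebras"
begin

text \<open>
  Write \<open>\<sigma> = (i j)(k l)\<close>. The map \<open>\<phi>(\<xi>) = - \<sigma>(\<xi>)\<close> is an antiautomorphism that fixes \<open>h = x\<^bsub>ij\<^esub>\<close>
  and \<open>c = x\<^bsub>kl\<^esub>\<close> and exchanges the raising and the lowering elements of weight 2 for \<open>ad h\<close>; the
  form is the analogue of the Shapovalov form for \<open>\<phi>\<close>.

  In the endomorphisms of a finite-dimensional module, \<open>h + x\<^bsub>jk\<^esub>\<close>, \<open>h + x\<^bsub>jl\<^esub>\<close>, \<open>x\<^bsub>ki\<^esub> + h\<close> and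
  \<open>x\<^bsub>li\<^esub> + h\<close> act, up to scalars, as \<open>e\<close>, \<open>t e\<close>, \<open>f\<close> and \<open>t\<^sup>-\<^sup>1 f\<close> in the loop algebra of \<open>sl\<^sub>2\<close>, and the
  weight components of \<open>c\<close> lie in the image of the loop algebra because \<open>1 - t\<close> is invertible there.
  So there is a highest weight vector \<open>v\<close>, on which the commuting elements \<open>H\<^sub>n\<close> act by scalars, the
  module is spanned by \<open>v\<close> and the images of the \<open>F\<^sub>n\<close>, and since \<open>\<phi>\<close> fixes all \<open>H\<^sub>n\<close>, the twisted dual
  module has the same highest weight. Irreducibility makes the submodule generated by the pair of
  highest weight vectors the graph of an isomorphism, which is the form. Every form with the same
  invariance is determined by its value at \<open>(v, v)\<close>, which gives uniqueness and symmetry.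
\<close>

section \<open>Polynomials in a linear operator\<close>

lemma (in Vector_Spaces.linear) sum_scale:
  "f (\<Sum>i\<in>A. s1 (c i) (x i)) = (\<Sum>i\<in>A. s2 (c i) (f (x i)))"
  by (simp add: sum scale)

text \<open>Dependence of the set \<open>range x\<close> says nothing about repetitions in the
  sequence, so a repeated value is treated apart and gives the relation
  \<open>monom 1 i - monom 1 j\<close>. The coefficients are packed into a polynomial so that the
  powers of an operator can be fed in.\<close>

lemma (in vector_space) sequence_dependent:
  fixes x :: "nat \<Rightarrow> 'b"
  assumes t: "finite t" and x: "range x \<subseteq> span t"
  obtains p where "p \<noteq> 0" "(\<Sum>n\<le>degree p. scale (coeff p n) (x n)) = 0"
proof (cases "inj x")
  case False
  then obtain i j where ij: "i \<noteq> j" "x i = x j" by (auto simp: inj_def)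
  define p :: "'a poly" where "p = monom 1 i - monom 1 j"
  have "coeff p i \<noteq> 0" using ij by (simp add: p_def)
  then have "p \<noteq> 0" by auto
  moreover have "(\<Sum>n\<le>degree p. scale (coeff p n) (x n)) =
      (\<Sum>n\<le>degree p + i + j. scale (coeff p n) (x n))"
    by (rule sum.mono_neutral_left) (auto simp: coeff_eq_0)
  moreover have "scale (coeff p n) (x n) = (if i = n then x n else 0) - (if j = n then x n else 0)" for n
    by (simp add: p_def)
  ultimately show ?thesis
    using ij that[of p] by (simp add: sum_subtractf)
next
  case True
  have "dependent (range x)"
    using independent_span_bound[OF t _ x] range_inj_infinite[OF True] by auto
  then obtain U u v where U: "finite U" "U \<subseteq> range x" "(\<Sum>v\<in>U. scale (u v) v) = 0" "v \<in> U" "u v \<noteq> 0"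
    unfolding dependent_explicit by blast
  define c where "c n = (if x n \<in> U then u (x n) else 0)" for n
  define S where "S = x -` U"
  have S: "finite S" "x ` S = U"
    using U True by (auto simp: S_def intro: finite_vimageI)
  define N where "N = Max S"
  have SN: "S \<subseteq> {..N}" using S by (auto simp: N_def)
  define p where "p = Poly (map c [0..<Suc N])"
  have cp: "coeff p n = c n" for n
    using SN by (auto simp: p_def coeff_Poly_eq nth_default_def c_def S_def simp del: upt_Suc)
  obtain m where "v = x m" using U by auto
  then have "coeff p m \<noteq> 0" using U by (simp add: cp c_def)
  then have "p \<noteq> 0" by auto
  moreover have "(\<Sum>n\<le>degree p. scale (coeff p n) (x n)) = (\<Sum>n\<in>S. scale (u (x n)) (x n))"
  proof -
    have "(\<Sum>n\<le>degree p. scale (coeff p n) (x n)) = (\<Sum>n\<le>max (degree p) N. scale (coeff p n) (x n))"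
      by (rule sum.mono_neutral_left) (auto simp: coeff_eq_0)
    also have "\<dots> = (\<Sum>n\<in>S. scale (u (x n)) (x n))"
      by (rule sum.mono_neutral_cong_right) (use SN in \<open>auto simp: cp c_def S_def\<close>)
    finally show ?thesis .
  qed
  moreover have "\<dots> = (\<Sum>v\<in>U. scale (u v) v)"
    using sum.reindex[OF inj_on_subset[OF True subset_UNIV, of S], of "\<lambda>v. scale (u v) v"] S(2) by simp
  ultimately show ?thesis using that[of p] U by simp
qed

locale linear_operator = vector_space scale
  for scale :: "'f::field \<Rightarrow> 'b::ab_group_add \<Rightarrow> 'b" +
  fixes T :: "'b \<Rightarrow> 'b"
  assumes linear_T: "Vector_Spaces.linear scale scale T"
begin

sublocale T: Vector_Spaces.linear scale scale T
  by (rule linear_T)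

definition poly_act :: "'f poly \<Rightarrow> 'b \<Rightarrow> 'b"
  where "poly_act p x = (\<Sum>n\<le>degree p. scale (coeff p n) ((T ^^ n) x))"

lemma poly_act_eq:
  fixes p :: "'f poly"
  assumes "degree p \<le> N"
  shows "poly_act p x = (\<Sum>n\<le>N. scale (coeff p n) ((T ^^ n) x))"
  unfolding poly_act_def
  by (rule sum.mono_neutral_left) (use assms in \<open>auto simp: coeff_eq_0\<close>)

lemma poly_act_add: "poly_act (p + q) x = poly_act p x + poly_act q x"
proof -
  define N where "N = max (degree p) (degree q)"
  have "degree (p + q) \<le> N" "degree p \<le> N" "degree q \<le> N"
    by (auto simp: N_def degree_add_le_max)
  then show ?thesis
    by (simp add: poly_act_eq scale_left_distrib sum.distrib)
qed

lemma poly_act_smult: "poly_act (smult c p) x = scale c (poly_act p x)"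
  using degree_smult_le[of c p] by (simp add: poly_act_eq[of _ "degree p"] scale_sum_right)

lemma poly_act_const: "poly_act [:c:] x = scale c x"
  by (simp add: poly_act_def)

lemma poly_act_shift:
  "poly_act (pCons 0 p) x = T (poly_act p x)"
proof -
  have "poly_act (pCons 0 p) x = (\<Sum>n\<le>Suc (degree p). scale (coeff (pCons 0 p) n) ((T ^^ n) x))"
    by (rule poly_act_eq) (simp add: degree_pCons_le)
  also have "\<dots> = T (poly_act p x)"
    by (simp only: sum.atMost_Suc_shift poly_act_def T.sum_scale) simp
  finally show ?thesis .
qed

lemma poly_act_linear_factor:
  "poly_act ([:- r, 1:] * q) x = T (poly_act q x) - scale r (poly_act q x)"
proof -
  have "[:- r, 1:] * q = smult (- r) q + pCons 0 q"
    by simp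
  then show ?thesis
    by (simp only: poly_act_add poly_act_smult poly_act_shift) simp
qed

lemma poly_act_commute:
  assumes "Vector_Spaces.linear scale scale S" "\<And>x. S (T x) = T (S x)"
  shows "S (poly_act p x) = poly_act p (S x)"
proof -
  interpret S: Vector_Spaces.linear scale scale S by fact
  have "S ((T ^^ n) x) = (T ^^ n) (S x)" for n
    by (induction n) (simp_all add: assms(2))
  then show ?thesis
    by (simp add: poly_act_def S.sum_scale)
qed

lemma linear_poly_act: "Vector_Spaces.linear scale scale (poly_act p)"
proof -
  have *: "(T ^^ n) (x + y) = (T ^^ n) x + (T ^^ n) y" "(T ^^ n) (scale c x) = scale c ((T ^^ n) x)" for n x y c
    by (induction n) (simp_all add: T.add T.scale)
  show ?thesis
    by unfold_locales
      (simp_all add: poly_act_def * scale_right_distrib sum.distrib scale_sum_right mult.commute)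
qed

text \<open>Division of \<open>p\<close> by \<open>X - r\<close> leaves the remainder
  \<open>p(r)\<close>, so on a vector killed by \<open>p(T)\<close> the quotient inverts
  \<open>r - T\<close> up to the factor \<open>p(r)\<close>. With \<open>r = 1\<close> this later
  inverts \<open>1 - t\<close>.\<close>

lemma poly_act_remainder:
  assumes "poly_act p x = 0"
  shows "scale (poly p r) x = poly_act (synthetic_div p r) (scale r x - T x)"
proof -
  interpret P: Vector_Spaces.linear scale scale "poly_act q" for q by (rule linear_poly_act)
  have "0 = poly_act ([:- r, 1:] * synthetic_div p r + [:poly p r:]) x"
    using assms by (simp only: synthetic_div_correct')
  also have "\<dots> = T (poly_act (synthetic_div p r) x) - scale r (poly_act (synthetic_div p r) x)
      + scale (poly p r) x"
    by (simp only: poly_act_add poly_act_linear_factor poly_act_const)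
  finally show ?thesis
    by (simp add: P.diff P.scale poly_act_commute[OF linear_T] algebra_simps)
qed

lemma minimal_annihilator:
  assumes "finite t" and "\<And>n. (T ^^ n) x \<in> span t"
  shows "\<exists>p. p \<noteq> 0 \<and> poly_act p x = 0 \<and> (\<forall>q. q \<noteq> 0 \<and> poly_act q x = 0 \<longrightarrow> degree p \<le> degree q)"
proof -
  obtain p where "p \<noteq> 0 \<and> poly_act p x = 0"
    unfolding poly_act_def
    by (rule sequence_dependent[OF assms(1), of "\<lambda>n. (T ^^ n) x"]) (use assms(2) in auto)
  from ex_has_least_nat[of "\<lambda>p. p \<noteq> 0 \<and> poly_act p x = 0" p degree, OF this]
  show ?thesis by (simp only: conj_assoc)
qed

text \<open>Cancelling the factor \<open>X - r\<close> lowers the degree, so by minimality the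
  cofactor does not kill \<open>x\<close>; its value at \<open>x\<close> is the eigenvector.\<close>

lemma minimal_annihilator_root:
  assumes "p \<noteq> 0" "poly_act p x = 0"
    and min: "\<forall>q. q \<noteq> 0 \<and> poly_act q x = 0 \<longrightarrow> degree p \<le> degree q"
    and "poly p r = 0"
  obtains q where "poly_act q x \<noteq> 0" "T (poly_act q x) = scale r (poly_act q x)"
proof -
  obtain q where q: "p = [:- r, 1:] * q"
    using \<open>poly p r = 0\<close> by (auto simp: poly_eq_0_iff_dvd)
  then have "q \<noteq> 0" "degree q < degree p"
    using \<open>p \<noteq> 0\<close> by (auto simp: degree_mult_eq simp del: mult_pCons_left)
  then have "poly_act q x \<noteq> 0"
    using min by fastforce
  moreover have "T (poly_act q x) = scale r (poly_act q x)"
    using \<open>poly_act p x = 0\<close> unfolding q poly_act_linear_factor by simp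
  ultimately show ?thesis by (rule that)
qed

lemma poly_act_closed:
  assumes "subspace W" "\<And>x. x \<in> W \<Longrightarrow> T x \<in> W" "x \<in> W"
  shows "poly_act p x \<in> W"
proof -
  have "(T ^^ n) x \<in> W" for n
    by (induction n) (use assms in auto)
  then show ?thesis
    unfolding poly_act_def using assms(1) by (intro subspace_sum subspace_scale)
qed

lemma eigenvectors_independent:
  assumes "finite S" "\<And>n. n \<in> S \<Longrightarrow> T (x n) = scale (\<mu> n) (x n)" "inj_on \<mu> S"
    "(\<Sum>n\<in>S. x n) = 0" "n \<in> S"
  shows "x n = 0"
  using assms
proof (induction S arbitrary: x n rule: finite_induct)
  case (insert m S)
  have m: "T (x m) = scale (\<mu> m) (x m)" by (simp add: insert.prems)
  have s: "x m + (\<Sum>n\<in>S. x n) = 0" using insert by simp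
  \<comment> \<open>Applying \<open>T - \<mu> m\<close> removes the summand \<open>x m\<close> and
    multiplies the others by nonzero factors.\<close>
  have "0 = T (x m + (\<Sum>n\<in>S. x n)) - scale (\<mu> m) (x m + (\<Sum>n\<in>S. x n))"
    by (simp add: s T.zero)
  also have "\<dots> = (\<Sum>n\<in>S. T (x n) - scale (\<mu> m) (x n))"
    by (simp add: T.add T.sum m scale_right_distrib scale_sum_right sum_subtractf)
  also have "\<dots> = (\<Sum>n\<in>S. scale (\<mu> n - \<mu> m) (x n))"
    by (rule sum.cong) (simp_all add: insert.prems scale_left_diff_distrib)
  finally have 0: "(\<Sum>n\<in>S. scale (\<mu> n - \<mu> m) (x n)) = 0" by simp
  have "scale (\<mu> k - \<mu> m) (x k) = 0" if "k \<in> S" for k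
    by (rule insert.IH[OF _ _ 0 that]) (use insert.prems in \<open>auto simp: T.scale scale_left_commute inj_on_def\<close>)
  then have z: "x k = 0" if "k \<in> S" for k
    using insert.prems(2) insert.hyps(2) that by (auto simp: inj_on_def)
  then have "x m = 0" using s by simp
  then show ?case using z insert.prems by auto
qed simp

lemma infinitely_many_eigenvalues:
  fixes x :: "nat \<Rightarrow> 'b"
  assumes "finite t" "range x \<subseteq> span t"
    and "\<And>n. T (x n) = scale (\<mu> n) (x n)" "inj \<mu>"
  shows "\<exists>n. x n = 0"
proof (rule ccontr)
  assume nz: "\<not> ?thesis"
  obtain p where p: "p \<noteq> 0" "(\<Sum>n\<le>degree p. scale (coeff p n) (x n)) = 0"
    by (rule sequence_dependent[OF assms(1,2)])
  have "scale (coeff p (degree p)) (x (degree p)) = 0"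
    by (rule eigenvectors_independent[OF _ _ _ p(2), of \<mu>])
      (use assms in \<open>auto simp: T.scale scale_left_commute intro: inj_on_subset\<close>)
  then show False using p nz by simp
qed

end

text \<open>An annihilating polynomial of least degree of a nonzero vector is not constant, so it
  has a root. The eigenvector stays in \<open>W\<close> because it is a polynomial in
  \<open>T\<close> applied to \<open>x\<close>.\<close>

lemma ex_eigenvector:
  fixes scale :: "'f::alg_closed_field \<Rightarrow> 'b::ab_group_add \<Rightarrow> 'b"
  assumes "linear_operator scale T"
    and "finite t" "W \<subseteq> module.span scale t" "module.subspace scale W"
    and TW: "\<And>x. x \<in> W \<Longrightarrow> T x \<in> W" and x: "x \<in> W" "x \<noteq> 0"
  obtains y r where "y \<in> W" "y \<noteq> 0" "T y = scale r y"
proof -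
  interpret linear_operator scale T by fact
  have "(T ^^ n) x \<in> W" for n
    by (induction n) (use TW x in auto)
  then have "(T ^^ n) x \<in> span t" for n
    using assms(3) by blast
  from minimal_annihilator[OF \<open>finite t\<close> this]
  obtain p where p: "p \<noteq> 0" "poly_act p x = 0"
    "\<forall>q. q \<noteq> 0 \<and> poly_act q x = 0 \<longrightarrow> degree p \<le> degree q"
    by (elim exE conjE)
  have "degree p > 0"
  proof (rule ccontr)
    assume "\<not> ?thesis"
    then obtain c where "p = [:c:]" by (auto elim: degree_eq_zeroE)
    then show False using p x by (simp add: poly_act_const)
  qed
  then obtain r where r: "poly p r = 0"
    using alg_closed_imp_poly_has_root by blast
  from minimal_annihilator_root[OF p r]
  obtain q where "poly_act q x \<noteq> 0" "T (poly_act q x) = scale r (poly_act q x)" .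
  with poly_act_closed[OF assms(4) TW x(1)] show ?thesis by (rule that)
qed

section \<open>The loop algebra of sl2\<close>

context lie_algebra
begin

lemma bracket_zero_left [simp]: "bracket 0 x = 0"
  using bracket_scale_left[of 0 0 x] by simp

lemma bracket_zero_right [simp]: "bracket x 0 = 0"
  using bracket_scale_right[of x 0 0] by simp

lemma bracket_minus_left [simp]: "bracket (- x) y = - bracket x y"
  using bracket_scale_left[of "-1" x y] by simp

lemma bracket_minus_right [simp]: "bracket x (- y) = - bracket x y"
  using bracket_scale_right[of x "-1" y] by simp

lemma bracket_diff_left: "bracket (x - y) z = bracket x z - bracket y z"
  using bracket_add_left[of x "- y" z] by simp

lemma bracket_diff_right: "bracket x (y - z) = bracket x y - bracket x z"
  using bracket_add_right[of x y "- z"] by simp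

lemmas bracket_simps = bracket_add_left bracket_add_right bracket_diff_left bracket_diff_right
  bracket_scale_left bracket_scale_right

lemma bracket_commute: "bracket x y = - bracket y x"
proof -
  have "bracket (x + y) (x + y) = bracket x y + bracket y x"
    unfolding bracket_add_left bracket_add_right by (simp add: bracket_self)
  then show ?thesis
    by (simp add: bracket_self eq_neg_iff_add_eq_0)
qed

lemma bracket_left_comm: "bracket x (bracket y z) = bracket (bracket x y) z + bracket y (bracket x z)"
proof -
  have "bracket y (bracket z x) = - bracket y (bracket x z)"
    by (subst (2) bracket_commute) simp
  moreover have "bracket z (bracket x y) = - bracket (bracket x y) z"
    by (rule bracket_commute)
  ultimately show ?thesis
    using jacobi[of x y z] by (simp add: algebra_simps)
qed

lemma bracket_assoc: "bracket (bracket x y) z = bracket x (bracket y z) - bracket y (bracket x z)"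
  by (simp add: bracket_left_comm[of x y z])

lemma bracket_sum_scale_right: "bracket x (\<Sum>i\<in>A. scale (c i) (y i)) = (\<Sum>i\<in>A. scale (c i) (bracket x (y i)))"
  by (induction A rule: infinite_finite_induct) (simp_all add: bracket_simps)

lemma bracket_sum_scale_left: "bracket (\<Sum>i\<in>A. scale (c i) (y i)) x = (\<Sum>i\<in>A. scale (c i) (bracket (y i) x))"
  by (induction A rule: infinite_finite_induct) (simp_all add: bracket_simps)

lemma linear_bracket: "linear_operator scale (bracket x)"
  by unfold_locales (simp_all add: bracket_simps)

end

text \<open>Finiteness is asked of the brackets only: the intended carrier is the type of all
  functions on a module, where just the commutators are sure to be linear maps.\<close>

locale fd_lie_algebra = lie_algebra scale bracket
  for scale :: "'f::field_char_0 \<Rightarrow> 'a::ab_group_add \<Rightarrow> 'a" (infixr "*s" 75) and bracket +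
  assumes brackets_fd: "\<exists>t. finite t \<and> (\<forall>x y. bracket x y \<in> span t)"
begin

text \<open>The string \<open>y n\<close> raised from \<open>x\<close> satisfies
  \<open>f y(n+1) = -(n+1)(m+n) y(n)\<close>. Finite dimension makes some member of the string
  vanish, and as no coefficient is zero, the vanishing descends to \<open>x\<close>.\<close>

lemma lowest_weight_positive:
  assumes ef: "bracket e f = h" and he: "bracket h e = 2 *s e"
    and x: "bracket h x = m *s x" "bracket f x = 0" and m: "\<And>n::nat. m \<noteq> - of_nat n"
  shows "x = 0"
proof -
  define y where "y n = (bracket e ^^ n) x" for n :: nat
  have h: "bracket h (y n) = (m + 2 * of_nat n) *s y n" for n
  proof (induction n)
    case (Suc n)
    show ?case
      by (simp add: y_def bracket_left_comm[of h e] he bracket_simps Suc[unfolded y_def] algebra_simps)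
  qed (simp add: y_def x)
  have f: "bracket f (y (Suc n)) = (- of_nat (Suc n) * (m + of_nat n)) *s y n" for n
  proof (induction n)
    case 0
    show ?case
      using h[of 0] by (simp add: y_def bracket_left_comm[of f e] bracket_commute[of f e] ef x)
  next
    case (Suc n)
    have "bracket f (y (Suc (Suc n))) = - bracket h (y (Suc n)) + bracket e (bracket f (y (Suc n)))"
      by (simp add: y_def bracket_left_comm[of f e "bracket e _"] bracket_commute[of f e] ef)
    also have "bracket e (bracket f (y (Suc n))) = (- of_nat (Suc n) * (m + of_nat n)) *s y (Suc n)"
      unfolding Suc by (simp add: bracket_simps y_def)
    finally show ?case
      unfolding h by (simp only: scale_minus_left[symmetric] scale_left_distrib[symmetric])
        (rule arg_cong[where f = "\<lambda>c. c *s _"], simp add: algebra_simps)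
  qed
  interpret H: linear_operator scale "bracket h" by (rule linear_bracket)
  obtain t where t: "finite t" "\<And>x y. bracket x y \<in> span t"
    using brackets_fd by blast
  \<comment> \<open>The shift by one keeps the sequence among the brackets; \<open>x\<close> itself
    need not lie in their span.\<close>
  have "\<exists>n. y (Suc n) = 0"
  proof (rule H.infinitely_many_eigenvalues[OF t(1)])
    show "range (\<lambda>n. y (Suc n)) \<subseteq> span t" using t(2) by (auto simp: y_def)
    show "bracket h (y (Suc n)) = (m + 2 * of_nat (Suc n)) *s y (Suc n)" for n by (rule h)
    show "inj (\<lambda>n. m + 2 * of_nat (Suc n))" by (auto simp: inj_def)
  qed
  then obtain n where n: "y (Suc n) = 0" by blast
  have "y n = 0 \<Longrightarrow> x = 0" for n
  proof (induction n)
    case (Suc n)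
    then have "(- of_nat (Suc n) * (m + of_nat n)) *s y n = 0"
      using f[of n] by simp
    moreover have "m + of_nat n \<noteq> 0" using m[of n] by (metis add_eq_0_iff2)
    ultimately have "y n = 0" by (metis of_nat_neq_0 mult_eq_0_iff neg_equal_0_iff_equal scale_eq_0_iff)
    then show ?case by (rule Suc.IH)
  qed (simp add: y_def)
  then show ?thesis using n by blast
qed

end

section \<open>Integer powers of an operator along one vector\<close>

definition int_iterate :: "('a \<Rightarrow> 'a) \<Rightarrow> ('a \<Rightarrow> 'a) \<Rightarrow> 'a \<Rightarrow> int \<Rightarrow> 'a"
  where "int_iterate S S' a n = (if 0 \<le> n then (S ^^ nat n) a else (S' ^^ nat (- n)) a)"

lemma int_iterate_0 [simp]: "int_iterate S S' a 0 = a"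
  by (simp add: int_iterate_def)

lemma int_iterate_uminus: "int_iterate S S' a (- n) = int_iterate S' S a n"
  by (simp add: int_iterate_def)

text \<open>The two maps need not be inverse everywhere: they commute and cancel on
  \<open>a\<close>, hence also on all iterates of \<open>a\<close>.\<close>

lemma int_iterate_add_1:
  assumes comm: "\<And>x. S (S' x) = S' (S x)" and a: "S (S' a) = a"
  shows "S (int_iterate S S' a n) = int_iterate S S' a (n + 1)"
proof (cases "0 \<le> n")
  case True
  then have "nat (n + 1) = Suc (nat n)" by simp
  with True show ?thesis by (simp add: int_iterate_def)
next
  case False
  define k where "k = nat (- n - 1)"
  have n: "n = - int k - 1" using False by (simp add: k_def)
  have *: "S (S' ((S' ^^ k) a)) = (S' ^^ k) a"
    by (induction k) (simp_all add: comm a[unfolded comm])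
  show ?thesis
    using * by (cases "k = 0") (simp_all add: int_iterate_def n nat_add_distrib)
qed

lemma int_iterate_diff_1:
  assumes "\<And>x. S (S' x) = S' (S x)" and "S (S' a) = a"
  shows "S' (int_iterate S S' a n) = int_iterate S S' a (n - 1)"
  using int_iterate_add_1[of S' S a "- n"] assms
  by (simp add: int_iterate_uminus[of S' S, symmetric] algebra_simps)

lemma int_iterate_induct:
  assumes "P a" "\<And>x. P x \<Longrightarrow> P (S x)" "\<And>x. P x \<Longrightarrow> P (S' x)"
  shows "P (int_iterate S S' a n)"
proof -
  have "P ((S ^^ k) a)" "P ((S' ^^ k) a)" for k
    by (induction k) (use assms in auto)
  then show ?thesis by (simp add: int_iterate_def)
qed

text \<open>
  The Chevalley generators \<open>e\<close>, \<open>t e\<close>, \<open>f\<close>, \<open>t\<^sup>-\<^sup>1 f\<close> of the loop algebra of \<open>sl\<^sub>2\<close>. The Serre relations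
  are not assumed: they follow from finite dimensionality.
\<close>

locale sl2_loop = fd_lie_algebra scale bracket
  for scale :: "'f::field_char_0 \<Rightarrow> 'a::ab_group_add \<Rightarrow> 'a" (infixr "*s" 75)
    and bracket (infixr "\<bullet>" 74) +
  fixes h e0 e1 f0 fm
  assumes he0: "h \<bullet> e0 = 2 *s e0" and he1: "h \<bullet> e1 = 2 *s e1"
    and hf0: "h \<bullet> f0 = - (2 *s f0)" and hfm: "h \<bullet> fm = - (2 *s fm)"
    and ef0: "e0 \<bullet> f0 = h" and efm: "e1 \<bullet> fm = h"
    and ee: "e0 \<bullet> e1 = 0" and ff: "f0 \<bullet> fm = 0"
begin

lemma fe0: "f0 \<bullet> e0 = - h" and fem: "fm \<bullet> e1 = - h"
  and ee': "e1 \<bullet> e0 = 0" and ff': "fm \<bullet> f0 = 0"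
  and eh0: "e0 \<bullet> h = - (2 *s e0)" and eh1: "e1 \<bullet> h = - (2 *s e1)"
  and fh0: "f0 \<bullet> h = 2 *s f0" and fhm: "fm \<bullet> h = 2 *s fm"
  using bracket_commute[of f0 e0] bracket_commute[of fm e1] bracket_commute[of e1 e0]
    bracket_commute[of fm f0] bracket_commute[of e0 h] bracket_commute[of e1 h]
    bracket_commute[of f0 h] bracket_commute[of fm h]
  by (simp_all add: ef0 efm ee ff he0 he1 hf0 hfm)

text \<open>In the loop algebra \<open>h1\<close> and \<open>hm\<close> are \<open>t h\<close> and
  \<open>t^-1 h\<close>.\<close>

definition "h1 = e1 \<bullet> f0"
definition "hm = e0 \<bullet> fm"

definition "D x = (1 / 2) *s (h1 \<bullet> x)"
definition "D' x = (1 / 2) *s (hm \<bullet> x)"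

lemma hh1: "h \<bullet> h1 = 0" and hhm: "h \<bullet> hm = 0"
  by (simp_all add: h1_def hm_def bracket_left_comm[of h] he0 he1 hf0 hfm bracket_simps)

lemma h1e0: "h1 \<bullet> e0 = 2 *s e1" and hme1: "hm \<bullet> e1 = 2 *s e0"
  and h1fm: "h1 \<bullet> fm = - (2 *s f0)" and hmf0: "hm \<bullet> f0 = - (2 *s fm)"
  by (simp_all add: h1_def hm_def bracket_assoc ef0 efm ee ff fe0 fem ee' ff' eh0 eh1 fh0 fhm)

lemma h1hm: "h1 \<bullet> hm = 0"
  unfolding hm_def
  by (simp add: bracket_left_comm[of h1] h1e0 h1fm bracket_simps efm ef0)

lemma D_bracket: "D (x \<bullet> y) = D x \<bullet> y + x \<bullet> D y"
  and D'_bracket: "D' (x \<bullet> y) = D' x \<bullet> y + x \<bullet> D' y"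
  by (simp_all add: D_def D'_def bracket_left_comm[of h1 x y] bracket_left_comm[of hm x y]
      bracket_simps scale_right_distrib)

lemma D_0 [simp]: "D 0 = 0" and D'_0 [simp]: "D' 0 = 0"
  by (simp_all add: D_def D'_def)

lemma D_minus: "D (- x) = - D x" and D'_minus: "D' (- x) = - D' x"
  by (simp_all add: D_def D'_def)

lemma D_scale: "D (c *s x) = c *s D x" and D'_scale: "D' (c *s x) = c *s D' x"
  by (simp_all add: D_def D'_def bracket_simps scale_left_commute)

lemma D_comm: "D (D' x) = D' (D x)"
  by (simp add: D_def D'_def bracket_simps bracket_left_comm[of h1 hm] h1hm)

lemma D_h: "D h = 0" "D' h = 0" "D h1 = 0" "D' h1 = 0" "D hm = 0" "D' hm = 0"
  using hh1 hhm h1hm bracket_commute[of h h1] bracket_commute[of h hm] bracket_commute[of h1 hm]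
  by (simp_all add: D_def D'_def bracket_self)

lemma D_e0: "D e0 = e1" and D'_e1: "D' e1 = e0" and D_fm: "D fm = - f0" and D'_f0: "D' f0 = - fm"
  by (simp_all add: D_def D'_def h1e0 hme1 h1fm hmf0)

text \<open>These are \<open>t^n e\<close>, \<open>t^n f\<close> and \<open>t^n h\<close>. The
  operator \<open>D\<close> multiplies by \<open>t\<close> on raising elements but by
  \<open>-t\<close> on lowering ones, whence the signs in \<open>F\<close>.\<close>

definition E :: "int \<Rightarrow> 'a" where "E = int_iterate D D' e0"
definition F :: "int \<Rightarrow> 'a" where "F = int_iterate (\<lambda>x. - D x) (\<lambda>x. - D' x) f0"
definition H :: "int \<Rightarrow> 'a" where "H n = E n \<bullet> F 0"

lemma D_E: "D (E n) = E (n + 1)" and D'_E: "D' (E n) = E (n - 1)"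
  unfolding E_def
  by (intro int_iterate_add_1 int_iterate_diff_1; simp add: D_comm D_e0 D'_e1)+

lemma D_F: "D (F n) = - F (n + 1)" and D'_F: "D' (F n) = - F (n - 1)"
proof -
  have "- D (F n) = F (n + 1)" "- D' (F n) = F (n - 1)"
    unfolding F_def
    by (rule int_iterate_add_1 int_iterate_diff_1; simp add: D_minus D'_minus D_comm[symmetric] D'_f0 D_fm)+
  then show "D (F n) = - F (n + 1)" "D' (F n) = - F (n - 1)"
    by (metis minus_minus)+
qed

lemma E_0: "E 0 = e0" and F_0: "F 0 = f0"
  by (simp_all add: E_def F_def)

lemma E_1: "E 1 = e1" and F_m1: "F (- 1) = fm"
  using D_E[of 0] D'_F[of 0] by (simp_all add: E_0 F_0 D_e0 D'_f0)

lemma h_D: "h \<bullet> D x = D (h \<bullet> x)" and h_D': "h \<bullet> D' x = D' (h \<bullet> x)"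
  by (simp_all add: D_def D'_def bracket_simps bracket_left_comm[of h] hh1 hhm)

lemma h_E: "h \<bullet> E n = 2 *s E n"
  unfolding E_def by (rule int_iterate_induct) (simp_all add: he0 h_D h_D' D_scale D'_scale)

lemma h_F: "h \<bullet> F n = - (2 *s F n)"
  unfolding F_def by (rule int_iterate_induct) (simp_all add: hf0 h_D h_D' D_scale D'_scale D_minus D'_minus)

lemma D_EF: "D (E i \<bullet> F j) = E (i + 1) \<bullet> F j - E i \<bullet> F (j + 1)"
  and D'_EF: "D' (E i \<bullet> F j) = E (i - 1) \<bullet> F j - E i \<bullet> F (j - 1)"
  by (simp_all add: D_bracket D'_bracket D_E D'_E D_F D'_F)

text \<open>Since \<open>D\<close> and \<open>D'\<close> kill both \<open>h\<close> and
  \<open>h1\<close>, applying \<open>D'\<close> to one equation and \<open>D\<close> to the other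
  moves the index by one; the two statements therefore have to be carried together.\<close>

lemma E_F_0_1: "E i \<bullet> F (- i) = h \<and> E (i + 1) \<bullet> F (- i) = h1"
proof (induction i rule: int_induct[of _ 0])
  case base
  show ?case by (simp add: E_0 F_0 E_1 ef0 h1_def)
next
  case (step1 i)
  have 1: "E (i + 1) \<bullet> F (- (i + 1)) = h"
    using D'_EF[of "i + 1" "- i"] step1 by (simp add: D_h)
  moreover have "E (i + 1 + 1) \<bullet> F (- (i + 1)) = h1"
    using D_EF[of "i + 1" "- (i + 1)"] step1 1 by (simp add: D_h)
  ultimately show ?case by blast
next
  case (step2 i)
  have 1: "E (i - 1 + 1) \<bullet> F (- (i - 1)) = h1"
    using D_EF[of i "- i"] step2 by (simp add: D_h)
  moreover have "E (i - 1) \<bullet> F (- (i - 1)) = h"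
    using D'_EF[of i "- (i - 1)"] step2 1 by (simp add: D_h)
  ultimately show ?case by blast
qed

text \<open>Computing \<open>h1 \<bullet> E i\<close> once by the Jacobi identity and once through
  \<open>D\<close> shows that \<open>F (- i)\<close> kills this bracket. It has weight 4 for the
  sl2-triple \<open>E i\<close>, \<open>h\<close>, \<open>F (- i)\<close>, and a lowest weight
  vector of positive weight is zero.\<close>

lemma E_E_adjacent: "E (i + 1) \<bullet> E i = 0"
proof (rule lowest_weight_positive)
  have F_E: "F (- j) \<bullet> E j = - h" for j
    using E_F_0_1[of j] bracket_commute[of "F (- j)" "E j"] by simp
  show "E i \<bullet> F (- i) = h" using E_F_0_1 by blast
  show "h \<bullet> E i = 2 *s E i" by (rule h_E)
  show "h \<bullet> E (i + 1) \<bullet> E i = 4 *s (E (i + 1) \<bullet> E i)"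
    by (simp add: bracket_left_comm[of h] h_E bracket_simps flip: scale_left_distrib)
  have "h1 \<bullet> E i = (E (i + 1) \<bullet> F (- i)) \<bullet> E i"
    using E_F_0_1[of i] by simp
  also have "\<dots> = - (E (i + 1) \<bullet> h) - F (- i) \<bullet> E (i + 1) \<bullet> E i"
    by (subst bracket_assoc) (simp add: F_E)
  also have "E (i + 1) \<bullet> h = - (2 *s E (i + 1))"
    using bracket_commute[of "E (i + 1)" h] by (simp add: h_E)
  finally have "h1 \<bullet> E i = 2 *s E (i + 1) - F (- i) \<bullet> E (i + 1) \<bullet> E i" by simp
  moreover have "h1 \<bullet> E i = 2 *s E (i + 1)"
    using D_E[of i] by (simp add: D_def flip: D_E)
  ultimately show "F (- i) \<bullet> E (i + 1) \<bullet> E i = 0" by simp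
  show "4 \<noteq> - (of_nat n :: 'f)" for n
  proof
    assume "4 = - (of_nat n :: 'f)"
    then have "of_nat (n + 4) = (0 :: 'f)" by (simp add: eq_neg_iff_add_eq_0 add.commute)
    then show False unfolding of_nat_eq_0_iff by simp
  qed
qed

text \<open>Applying \<open>D\<close> to a vanishing bracket relates index distances
  \<open>k\<close> and \<open>k + 2\<close>, so the induction carries two consecutive
  distances.\<close>

lemma E_E: "E i \<bullet> E j = 0"
proof -
  have *: "E i \<bullet> E (i + int k) = 0 \<and> E i \<bullet> E (i + int k + 1) = 0" for i k
  proof (induction k arbitrary: i)
    case 0
    then show ?case
      using E_E_adjacent[of i] bracket_commute[of "E i" "E (i + 1)"] by (simp add: bracket_self)
  next
    case (Suc k)
    have "0 = D (E i \<bullet> E (i + int k + 1))" using Suc by simp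
    also have "\<dots> = E (i + 1) \<bullet> E (i + 1 + int k) + E i \<bullet> E (i + int k + 2)"
      unfolding D_bracket by (simp add: D_E ac_simps)
    finally show ?case using Suc[of i] Suc[of "i + 1"] by (simp add: ac_simps)
  qed
  show ?thesis
  proof (cases "i \<le> j")
    case True
    then show ?thesis using *[of i "nat (j - i)"] by simp
  next
    case False
    then show ?thesis using *[of j "nat (i - j)"] bracket_commute[of "E i" "E j"] by simp
  qed
qed

text \<open>Exchanging raising and lowering elements replaces \<open>t\<close> by its inverse. This
  symmetry yields the statements on \<open>F\<close> and on negative degrees from those on
  \<open>E\<close> and on nonnegative degrees.\<close>

lemma mirror: "sl2_loop scale bracket (- h) f0 fm e0 e1"
  by unfold_locales (simp_all add: he0 he1 hf0 hfm fe0 fem ee ff)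

lemma mirror_E: "sl2_loop.E scale bracket f0 fm e0 e1 n = F (- n)" (is ?e)
  and mirror_F: "sl2_loop.F scale bracket f0 fm e0 e1 n = E (- n)" (is ?f)
proof -
  interpret m: sl2_loop scale bracket "- h" f0 fm e0 e1 by (rule mirror)
  have "m.D x = - D' x" "m.D' x = - D x" for x
    using bracket_commute[of f0 e1] bracket_commute[of fm e0]
    by (simp_all add: m.D_def m.D'_def D_def D'_def m.h1_def m.hm_def h1_def hm_def)
  then have "m.D = (\<lambda>x. - D' x)" "m.D' = (\<lambda>x. - D x)" by auto
  then show ?e ?f
    by (simp_all add: m.E_def m.F_def E_def F_def int_iterate_uminus)
qed

lemma F_F: "F i \<bullet> F j = 0"
proof -
  interpret m: sl2_loop scale bracket "- h" f0 fm e0 e1 by (rule mirror)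
  show ?thesis using m.E_E[of "- i" "- j"] by (simp add: mirror_E)
qed

text \<open>
  For fixed \<open>i + j = k + 1\<close> the brackets of \<open>E i\<close> and \<open>F j\<close> form an arithmetic progression with
  difference \<open>C / 2\<close>, where \<open>C\<close> is the bracket of \<open>h1\<close> and \<open>H k\<close>; expanding \<open>C\<close> through
  \<open>h1\<close> instead gives \<open>C = - k C\<close>.
\<close>

lemma loop_relations_nat:
  "(\<forall>i. E i \<bullet> F (int k - i) = H (int k)) \<and> (\<forall>j. H (int k) \<bullet> E j = 2 *s E (j + int k)) \<and>
    (\<forall>j. H (int k) \<bullet> F j = - (2 *s F (j + int k)))"
proof (induction k)
  case 0
  show ?case
    using E_F_0_1 by (simp add: H_def h_E h_F E_F_0_1[of 0, simplified])
next
  case (Suc k)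
  define C where "C = h1 \<bullet> H (int k)"
  define b where "b i = E i \<bullet> F (int k + 1 - i)" for i
  have b: "C = 2 *s (b (i + 1) - b i)" for i
  proof -
    have "D (H (int k)) = b (i + 1) - b i"
      using D_EF[of i "int k - i"] Suc by (simp add: b_def algebra_simps)
    moreover have "C = 2 *s D (H (int k))"
      by (simp add: C_def D_def)
    ultimately show ?thesis by simp
  qed
  have "b (i + int n) = b i + (of_nat n / 2) *s C" for i n
  proof (induction n)
    case (Suc n)
    have "b (i + int (Suc n)) = b (i + int n) + (1 / 2) *s C"
      by (simp add: b[of "i + int n"] ac_simps)
    then show ?case
      by (simp add: Suc add_divide_distrib scale_left_distrib)
  qed simp
  from this[of 1 k] have bk: "b (int k + 1) - b 1 = (of_nat k / 2) *s C"
    by (simp add: add.commute)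
  have "H (int k) \<bullet> h1 = 2 *s (b (int k + 1) - b 1)"
  proof -
    have "H (int k) \<bullet> h1 = (H (int k) \<bullet> E 1) \<bullet> F 0 + E 1 \<bullet> H (int k) \<bullet> F 0"
      using bracket_left_comm[of "H (int k)" e1 f0] by (simp only: h1_def E_1 F_0)
    also have "H (int k) \<bullet> E 1 = 2 *s E (int k + 1)"
      using Suc by (simp add: add.commute)
    also have "H (int k) \<bullet> F 0 = - (2 *s F (int k))"
      using Suc by simp
    finally show ?thesis
      by (simp add: b_def bracket_scale_left bracket_scale_right scale_right_diff_distrib)
  qed
  then have "- C = of_nat k *s C"
    by (simp add: C_def[symmetric] bk bracket_commute[of "H (int k)" h1])
  then have "(of_nat (Suc k)) *s C = 0"
    by (simp add: scale_left_distrib flip: \<open>- C = _\<close>)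
  then have "C = 0" by (simp del: of_nat_Suc)
  then have bs: "b (i + 1) = b i" for i using b[of i] by simp
  have b0: "b i = b 0" for i
  proof (induction i rule: int_induct[of _ 0])
    case (step1 i)
    then show ?case using bs[of i] by simp
  next
    case (step2 i)
    then show ?case using bs[of "i - 1"] by simp
  qed simp
  then have EF: "E i \<bullet> F (int (Suc k) - i) = H (int (Suc k))" for i
    using b0[of i] b0[of "int k + 1"] by (simp add: b_def H_def add.commute)
  moreover have "H (int (Suc k)) \<bullet> E j = 2 *s E (j + int (Suc k))" for j
  proof -
    \<comment> \<open>The splitting of the degree \<open>k + 1\<close> is free by now; this choice
      makes the inner bracket equal to \<open>- H k\<close>, to which the induction hypothesis
      applies.\<close>
    have "H (int (Suc k)) \<bullet> E j = (E (j + 1) \<bullet> F (int k - j)) \<bullet> E j"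
      using EF[of "j + 1"] by simp
    also have "\<dots> = E (j + 1) \<bullet> F (int k - j) \<bullet> E j"
      by (subst bracket_assoc) (simp add: E_E)
    also have "F (int k - j) \<bullet> E j = - H (int k)"
      using Suc bracket_commute[of "F (int k - j)" "E j"] by simp
    also have "E (j + 1) \<bullet> - H (int k) = H (int k) \<bullet> E (j + 1)"
      using bracket_commute[of "E (j + 1)" "H (int k)"] by simp
    finally show ?thesis using Suc by (simp add: ac_simps)
  qed
  moreover have "H (int (Suc k)) \<bullet> F j = - (2 *s F (j + int (Suc k)))" for j
  proof -
    have "H (int (Suc k)) \<bullet> F j = (E (int k - j) \<bullet> F (j + 1)) \<bullet> F j"
      using EF[of "int k - j"] by (simp add: add.commute)
    also have "\<dots> = - (F (j + 1) \<bullet> E (int k - j) \<bullet> F j)"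
      by (subst bracket_assoc) (simp add: F_F)
    also have "E (int k - j) \<bullet> F j = H (int k)"
      using spec[OF conjunct1[OF Suc], of "int k - j"] by simp
    also have "- (F (j + 1) \<bullet> H (int k)) = H (int k) \<bullet> F (j + 1)"
      using bracket_commute[of "F (j + 1)" "H (int k)"] by simp
    finally show ?thesis using Suc by (simp add: ac_simps)
  qed
  ultimately show ?case by blast
qed

text \<open>Nonnegative degrees are settled; negative ones come from the mirrored locale, whose
  \<open>H k\<close> is \<open>- H (- k)\<close>.\<close>

lemma loop_relations:
  "E i \<bullet> F j = H (i + j)" (is ?EF)
  "H i \<bullet> E j = 2 *s E (i + j)" (is ?HE)
  "H i \<bullet> F j = - (2 *s F (i + j))" (is ?HF)
proof -
  interpret m: sl2_loop scale bracket "- h" f0 fm e0 e1 by (rule mirror)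
  have neg: "F (- i) \<bullet> E (i - int k) = F (- int k) \<bullet> E 0" for i k
    using m.loop_relations_nat[of k] by (simp add: m.H_def mirror_E mirror_F)
  have neg': "E i \<bullet> F (- i - int k) = E 0 \<bullet> F (- int k)" for i k
    using neg[of "i + int k" k] bracket_commute[of "E i" "F (- i - int k)"]
      bracket_commute[of "E 0" "F (- int k)"] by (simp add: add.commute)
  have mH: "m.H (int k) = - H (- int k)" for k
    using neg'[of "- int k" k] bracket_commute[of "E 0" "F (- int k)"]
    by (simp add: m.H_def mirror_E mirror_F H_def)
  have 1: "E i \<bullet> F (n - i) = H n" for i n
  proof (cases "0 \<le> n")
    case True
    then show ?thesis using loop_relations_nat[of "nat n"] by simp
  next
    case False
    then show ?thesis using neg'[of i "nat (- n)"] neg'[of n "nat (- n)"] by (simp add: H_def add.commute)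
  qed
  show ?EF using 1[of i "i + j"] by simp
  show ?HE
  proof (cases "0 \<le> i")
    case True
    then show ?thesis using loop_relations_nat[of "nat i"] by (simp add: add.commute)
  next
    case False
    then show ?thesis
      using conjunct2[OF conjunct2[OF m.loop_relations_nat[of "nat (- i)"]], THEN spec, of "- j"] mH[of "nat (- i)"]
      by (simp add: mirror_E mirror_F add.commute)
  qed
  show ?HF
  proof (cases "0 \<le> i")
    case True
    then show ?thesis using loop_relations_nat[of "nat i"] by (simp add: add.commute)
  next
    case False
    then have "- (H i \<bullet> F j) = 2 *s F (i + j)"
      using conjunct1[OF conjunct2[OF m.loop_relations_nat[of "nat (- i)"]], THEN spec, of "- j"] mH[of "nat (- i)"]
      by (simp add: mirror_E mirror_F add.commute)
    then show ?thesis by (metis minus_minus)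
  qed
qed

text \<open>With \<open>H j\<close> written as \<open>E j \<bullet> F 0\<close>, the Jacobi identity
  gives \<open>2 H (i + j) - 2 H (i + j)\<close>.\<close>

lemma H_H: "H i \<bullet> H j = 0"
  using bracket_left_comm[of "H i" "E j" "F 0"]
  by (simp add: loop_relations bracket_simps add.commute)

lemma H_0: "H 0 = h"
  by (simp add: H_def E_0 F_0 ef0)

end

section \<open>The tetrahedron relations\<close>

text \<open>The elements \<open>cp\<close>, \<open>c0\<close>, \<open>cm\<close> stand for the
  components of \<open>x_kl\<close> of weights 2, 0, -2 under \<open>ad h\<close>. The assumptions
  are weight components of the triangle relations of \<open>x_kl\<close> with \<open>x_jk\<close>,
  \<open>x_jl\<close> and \<open>x_ik\<close>.\<close>

locale tetrahedron_loop = sl2_loop scale bracket h e0 e1 f0 fm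
  for scale :: "'f::field_char_0 \<Rightarrow> 'a::ab_group_add \<Rightarrow> 'a" (infixr "*s" 75)
    and bracket (infixr "\<bullet>" 74) and h e0 e1 f0 fm +
  fixes c0 cp cm
  assumes e0c0: "e0 \<bullet> c0 = 2 *s e0 + 4 *s cp" and e1c0: "e1 \<bullet> c0 = 4 *s cp - 2 *s e1"
    and e1cp: "e1 \<bullet> cp = 0" and e1cm: "e1 \<bullet> cm = 2 *s c0 + 2 *s h"
    and f0cp: "f0 \<bullet> cp = (1 / 2) *s (h + c0)" and f0cm: "f0 \<bullet> cm = 0"
    and f0c0: "f0 \<bullet> c0 = 2 *s f0 + cm"
begin

lemma f0e1: "f0 \<bullet> e1 = - h1"
  by (simp add: h1_def bracket_commute[of f0 e1])

lemma scale_half_add: "(1 / 2) *s x + (1 / 2) *s x = x"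
  by (simp flip: scale_left_distrib)

lemma scale_2_add: "2 *s x + 2 *s x = 4 *s x"
  by (simp flip: scale_left_distrib)

lemma D_c0: "D c0 = 0"
proof -
  have "h1 \<bullet> c0 = 0"
    by (simp add: h1_def bracket_assoc f0c0 e1c0 bracket_simps e1cm f0cp f0e1)
      (simp add: h1_def scale_right_distrib)
  then show ?thesis by (simp add: D_def)
qed

text \<open>With \<open>D\<close> read as multiplication by \<open>t\<close>, this is the equation
  \<open>(1 - t) cp = e1\<close>; the lemma on \<open>cm\<close> similarly reads
  \<open>(1 - t) cm = - 4 f0\<close>.\<close>

lemma D_cp: "D cp = cp - e1"
  by (simp add: D_def h1_def bracket_assoc f0cp e1cp bracket_simps eh1 e1c0 algebra_simps scale_half_add)

lemma D_cm: "D cm = - (4 *s f0) - cm"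
  by (simp add: D_def h1_def bracket_assoc f0cm e1cm bracket_simps fh0 f0c0 algebra_simps scale_2_add)

text \<open>Multiplication by \<open>t\<close> on the lowering side, where \<open>D\<close> itself
  is \<open>-t\<close>.\<close>

definition D_neg :: "'a \<Rightarrow> 'a" where "D_neg x = - D x"

sublocale D: linear_operator scale D
  by unfold_locales (simp_all add: D_def bracket_simps scale_right_distrib mult.commute)

sublocale D_neg: linear_operator scale D_neg
  by unfold_locales (simp_all add: D_neg_def D.T.add D.T.scale)

lemma D_pow_E: "(D ^^ n) (E i) = E (i + int n)"
  by (induction n) (simp_all add: D_E ac_simps)

lemma D_neg_pow_F: "(D_neg ^^ n) (F i) = F (i + int n)"
  by (induction n) (simp_all add: D_neg_def D_F ac_simps)

lemma linear_bracket_c0: "Vector_Spaces.linear scale scale (bracket c0)"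
  using linear_operator.linear_T[OF linear_bracket] .

lemma D_bracket_c0: "D (c0 \<bullet> x) = c0 \<bullet> D x"
  by (simp add: D_bracket D_c0)

text \<open>
  Here \<open>D\<close> is multiplication by \<open>t\<close>, and \<open>(1 - D) (ad c0) = - 2 (1 + D)\<close>, so \<open>D y = y\<close> forces
  \<open>4 y = 0\<close>.
\<close>

lemma fixed_by_D:
  assumes "D (D.poly_act q e0) = D.poly_act q e0"
  shows "D.poly_act q e0 = 0"
proof -
  define y where "y = D.poly_act q e0"
  \<comment> \<open>The identity is claimed only on the cyclic space of \<open>e0\<close>:
    \<open>Z\<close> is linear, commutes with \<open>D\<close> and kills \<open>e0\<close>.\<close>
  define Z where "Z x = c0 \<bullet> x - D (c0 \<bullet> x) + 2 *s (x + D x)" for x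
  have Z_add: "Z (x + x') = Z x + Z x'" and Z_scale: "Z (c *s x) = c *s Z x" for x x' c
    by (simp_all add: Z_def bracket_simps D.T.add D.T.scale algebra_simps)
  define K where "K = {x. Z x = 0}"
  have "y \<in> K"
    unfolding y_def
  proof (rule D.poly_act_closed)
    show "subspace K"
      using Z_scale[of 0 0] by (intro subspaceI) (simp_all add: K_def Z_add Z_scale)
    show "D x \<in> K" if "x \<in> K" for x
    proof -
      have "Z (D x) = D (Z x)"
        by (simp add: Z_def D_bracket_c0 D.T.add D.T.diff D.T.scale)
      with that show ?thesis by (simp add: K_def)
    qed
    have w: "c0 \<bullet> e0 = - (2 *s e0 + 4 *s cp)"
      by (subst bracket_commute) (simp add: e0c0)
    have "Z e0 = 0"
      unfolding Z_def w by (simp add: D.T.add D.T.scale D.T.neg D.T.diff D_cp D_e0 algebra_simps scale_2_add)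
    then show "e0 \<in> K" by (simp add: K_def)
  qed
  moreover have "D (c0 \<bullet> y) = c0 \<bullet> y"
    using assms by (simp add: D_bracket_c0 y_def)
  ultimately have "4 *s y = 0"
    using assms by (simp add: K_def Z_def y_def scale_right_distrib scale_2_add)
  then show ?thesis by (simp add: y_def)
qed

text \<open>A least annihilator \<open>p\<close> of \<open>e0\<close> under \<open>D\<close> also
  kills \<open>cp\<close>, and \<open>cm\<close> on the lowering side; as \<open>p(1)\<close> is
  nonzero, \<open>1 - t\<close> can be inverted in the equations for \<open>cp\<close> and
  \<open>cm\<close>. The same coefficients \<open>\<gamma>\<close> serve all components, which is
  what lets the antiautomorphism exchange \<open>cp\<close> and \<open>cm\<close>.\<close>

lemma c_in_loop_algebra:
  obtains m :: nat and \<gamma> where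
    "cp = (\<Sum>n\<le>m. \<gamma> n *s E (int n + 1))"
    "cm = (\<Sum>n\<le>m. \<gamma> n *s - (4 *s F (int n)))"
    "c0 = (\<Sum>n\<le>m. \<gamma> n *s - (2 *s H (int n + 1))) - h"
proof -
  obtain t where t: "finite t" "\<And>x y. x \<bullet> y \<in> span t"
    using brackets_fd by blast
  have "(D ^^ n) e0 \<in> span t" for n
  proof (cases n)
    case 0
    have "e0 = (1 / 2) *s (h \<bullet> e0)" by (simp add: he0)
    with 0 show ?thesis using span_scale[OF t(2)] by (metis funpow_0)
  next
    case (Suc k)
    then show ?thesis using span_scale[OF t(2)] by (simp add: D_def)
  qed
  from D.minimal_annihilator[OF t(1) this]
  obtain p where p: "p \<noteq> 0" "D.poly_act p e0 = 0"
    "\<forall>q. q \<noteq> 0 \<and> D.poly_act q e0 = 0 \<longrightarrow> degree p \<le> degree q"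
    by (elim exE conjE)
  \<comment> \<open>A root 1 would produce a nonzero vector of the cyclic space fixed by
    \<open>D\<close>.\<close>
  have p1: "poly p 1 \<noteq> 0"
  proof
    assume "poly p 1 = 0"
    from D.minimal_annihilator_root[OF p this] fixed_by_D show False by auto
  qed
  have E: "(\<Sum>n\<le>degree p. coeff p n *s E (int n)) = 0"
    using p(2) D_pow_E[of _ 0] by (simp add: D.poly_act_def E_0)
  \<comment> \<open>Bracketing with \<open>F 0\<close> turns the relation among the
    \<open>E n\<close> into one among the \<open>H n\<close>, and once more into one among the
    \<open>F n\<close>.\<close>
  have H: "(\<Sum>n\<le>degree p. coeff p n *s H (int n)) = 0"
    using arg_cong[OF E, of "\<lambda>x. x \<bullet> F 0"] by (simp add: bracket_sum_scale_left loop_relations)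
  have "- (2 *s (\<Sum>n\<le>degree p. coeff p n *s F (int n))) = 0"
    using arg_cong[OF H, of "\<lambda>x. x \<bullet> F 0"]
    by (simp add: bracket_sum_scale_left loop_relations scale_sum_right sum_negf mult.commute)
  then have pf: "D_neg.poly_act p f0 = 0"
    using D_neg_pow_F[of _ 0] by (simp add: D_neg.poly_act_def F_0)
  define r where "r = synthetic_div p 1"
  have "D.poly_act p cp = 0"
  proof -
    interpret P: Vector_Spaces.linear scale scale "D.poly_act p" by (rule D.linear_poly_act)
    \<comment> \<open>So \<open>cp\<close> is a combination of \<open>e0\<close> and
      \<open>c0 \<bullet> e0\<close>, and \<open>p(D)\<close> commutes with
      \<open>ad c0\<close>.\<close>
    have "cp = (1 / 4) *s (- (c0 \<bullet> e0) - 2 *s e0)"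
      by (simp add: bracket_commute[of c0 e0] e0c0)
    also have "D.poly_act p \<dots> = 0"
      by (simp add: P.scale P.diff P.neg p(2)
          D.poly_act_commute[OF linear_bracket_c0 D_bracket_c0[symmetric], symmetric])
    finally show ?thesis .
  qed
  from D.poly_act_remainder[OF this, of 1]
  have cp: "poly p 1 *s cp = (\<Sum>n\<le>degree r. coeff r n *s E (int n + 1))"
    using D_pow_E[of _ 1] by (simp add: D_cp r_def D.poly_act_def E_1 add.commute)
  have "D_neg.poly_act p cm = 0"
  proof -
    interpret P: Vector_Spaces.linear scale scale "D_neg.poly_act p" by (rule D_neg.linear_poly_act)
    have "cm = - (c0 \<bullet> f0) - 2 *s f0"
      by (simp add: bracket_commute[of c0 f0] f0c0)
    also have "D_neg.poly_act p \<dots> = 0"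
      using D_neg.poly_act_commute[OF linear_bracket_c0, of p f0]
      by (simp add: P.scale P.diff P.neg pf D_bracket_c0 D_neg_def)
    finally show ?thesis .
  qed
  from D_neg.poly_act_remainder[OF this, of 1]
  have "poly p 1 *s cm = D_neg.poly_act r (- (4 *s f0))"
    by (simp add: D_cm D_neg_def r_def)
  also have "\<dots> = - (4 *s D_neg.poly_act r f0)"
  proof -
    interpret P: Vector_Spaces.linear scale scale "D_neg.poly_act r" by (rule D_neg.linear_poly_act)
    show ?thesis by (simp add: P.scale P.neg)
  qed
  also have "\<dots> = (\<Sum>n\<le>degree r. coeff r n *s - (4 *s F (int n)))"
    using D_neg_pow_F[of _ 0]
    by (simp add: D_neg.poly_act_def F_0 scale_sum_right sum_negf mult.commute)
  finally have cm: "poly p 1 *s cm = (\<Sum>n\<le>degree r. coeff r n *s - (4 *s F (int n)))" .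
  define \<gamma> where "\<gamma> n = coeff r n / poly p 1" for n
  have cp': "cp = (\<Sum>n\<le>degree r. \<gamma> n *s E (int n + 1))"
  proof -
    have "cp = (1 / poly p 1) *s (poly p 1 *s cp)" using p1 by simp
    then show ?thesis unfolding cp by (simp add: scale_sum_right \<gamma>_def)
  qed
  have cm': "cm = (\<Sum>n\<le>degree r. \<gamma> n *s - (4 *s F (int n)))"
  proof -
    have "cm = (1 / poly p 1) *s (poly p 1 *s cm)" using p1 by simp
    then show ?thesis unfolding cm by (simp add: scale_sum_right \<gamma>_def)
  qed
  have fE: "f0 \<bullet> E (int n + 1) = - H (int n + 1)" for n
    using bracket_commute[of "F 0" "E (int n + 1)"] by (simp add: H_def F_0)
  have "c0 = 2 *s (f0 \<bullet> cp) - h"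
    by (simp add: f0cp)
  also have "f0 \<bullet> cp = (\<Sum>n\<le>degree r. \<gamma> n *s - H (int n + 1))"
    by (subst cp') (simp add: bracket_sum_scale_right fE)
  finally have "c0 = (\<Sum>n\<le>degree r. \<gamma> n *s - (2 *s H (int n + 1))) - h"
    by (simp add: scale_sum_right mult.commute)
  with cp' cm' show ?thesis by (rule that)
qed

end

lemma (in linear_operator) eigenvectors_sum_zero_3:
  assumes "T x = scale a x" "T y = scale b y" "T z = scale c z"
    and "a \<noteq> b" "a \<noteq> c" "b \<noteq> c" and "x + y + z = 0"
  shows "x = 0" "y = 0" "z = 0"
proof -
  define w where "w n = [x, y, z] ! n" for n
  define \<mu> where "\<mu> n = [a, b, c] ! n" for n
  have "w n = 0" if "n < 3" for n
  proof (rule eigenvectors_independent[of "{..<3}" w \<mu>])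
    show "inj_on \<mu> {..<3}"
      using assms(4-6) by (auto simp: inj_on_def \<mu>_def less_Suc_eq numeral_eq_Suc)
    show "(\<Sum>n<3. w n) = 0"
      using assms(7) by (simp add: w_def numeral_eq_Suc)
    show "T (w m) = scale (\<mu> m) (w m)" if "m \<in> {..<3}" for m
      using that assms(1-3) by (auto simp: w_def \<mu>_def less_Suc_eq numeral_eq_Suc)
  qed (use that in auto)
  from this[of 0] this[of 1] this[of 2] show "x = 0" "y = 0" "z = 0"
    by (simp_all add: w_def)
qed

locale tetrahedron_elements = fd_lie_algebra scale bracket
  for scale :: "'f::field_char_0 \<Rightarrow> 'a::ab_group_add \<Rightarrow> 'a" (infixr "*s" 75)
    and bracket (infixr "\<bullet>" 74) +
  fixes y :: "4 \<Rightarrow> 4 \<Rightarrow> 'a" and i j k l :: 4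
  assumes ijkl: "distinct [i, j, k, l]"
    and skew: "\<And>i j. i \<noteq> j \<Longrightarrow> y i j + y j i = 0"
    and triangle: "\<And>i j k. distinct [i, j, k] \<Longrightarrow> y i j \<bullet> y j k = 2 *s y i j + 2 *s y j k"
    and dolan_grady: "\<And>i j k l. distinct [i, j, k, l] \<Longrightarrow>
      y i j \<bullet> y i j \<bullet> y i j \<bullet> y k l = 4 *s (y i j \<bullet> y k l)"
begin

definition "h = y i j"
definition "e0 = h + y j k"
definition "e1 = h + y j l"
text \<open>The factor normalizes the pair so that \<open>e0 \<bullet> f0 = h\<close>.\<close>

definition "f0 = (- 1 / 4) *s (y k i + h)"
definition "fm = (- 1 / 4) *s (y l i + h)"
definition "c = y k l"
text \<open>The Dolan-Grady relation says that \<open>X (X - 2) (X + 2)\<close> at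
  \<open>ad h\<close> kills \<open>c\<close>. The next three formulas are the Lagrange projections
  of \<open>c\<close> to the eigenvalues 0, 2 and -2.\<close>

definition "c0 = c - (1 / 4) *s (h \<bullet> h \<bullet> c)"
definition "cp = (1 / 8) *s (h \<bullet> h \<bullet> c + 2 *s (h \<bullet> c))"
definition "cm = (1 / 8) *s (h \<bullet> h \<bullet> c - 2 *s (h \<bullet> c))"

lemma neq [simp]:
  "i \<noteq> j" "j \<noteq> i" "i \<noteq> k" "k \<noteq> i" "i \<noteq> l" "l \<noteq> i"
  "j \<noteq> k" "k \<noteq> j" "j \<noteq> l" "l \<noteq> j" "k \<noteq> l" "l \<noteq> k"
  using ijkl by auto

lemma y_flip: "a \<noteq> b \<Longrightarrow> y a b = - y b a"
  using skew by (simp add: eq_neg_iff_add_eq_0)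

lemma double: "2 *s x = x + x"
  using scale_left_distrib[of 1 1 x] by simp

lemma quadruple: "4 *s x = x + x + x + x"
  using scale_left_distrib[of 2 2 x] by (simp add: double)

lemma h_y:
  assumes "a \<noteq> i" "a \<noteq> j"
  shows "h \<bullet> y j a = 2 *s h + 2 *s y j a" "h \<bullet> y a i = - (2 *s h) - 2 *s y a i"
proof -
  have "distinct [i, j, a]" "distinct [a, i, j]" using assms ijkl by auto
  from triangle[OF this(1)] triangle[OF this(2)] bracket_commute[of h "y a i"]
  show "h \<bullet> y j a = 2 *s h + 2 *s y j a" "h \<bullet> y a i = - (2 *s h) - 2 *s y a i"
    by (simp_all add: h_def)
qed

lemma y_h:
  assumes "a \<noteq> i" "a \<noteq> j"
  shows "y j a \<bullet> h = - (2 *s h) - 2 *s y j a" "y a i \<bullet> h = 2 *s h + 2 *s y a i"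
  using h_y[OF assms] bracket_commute[of _ h] by simp_all

lemma h_e0: "h \<bullet> e0 = 2 *s e0" and h_e1: "h \<bullet> e1 = 2 *s e1"
  using ijkl by (simp_all add: e0_def e1_def bracket_simps bracket_self h_y scale_right_distrib)

lemma h_f0: "h \<bullet> f0 = - (2 *s f0)" and h_fm: "h \<bullet> fm = - (2 *s fm)"
  using ijkl
  by (simp_all add: f0_def fm_def bracket_simps bracket_self h_y scale_right_distrib scale_right_diff_distrib)

lemma e0_f0: "e0 \<bullet> f0 = h" and e1_fm: "e1 \<bullet> fm = h"
proof -
  have "y j k \<bullet> y k i = 2 *s y j k + 2 *s y k i" "y j l \<bullet> y l i = 2 *s y j l + 2 *s y l i"
    using ijkl by (auto intro: triangle)
  then have "e0 \<bullet> (y k i + h) = - (4 *s h)" "e1 \<bullet> (y l i + h) = - (4 *s h)"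
    using ijkl
    by (simp_all add: e0_def e1_def bracket_simps bracket_self h_y y_h double quadruple)
  then show "e0 \<bullet> f0 = h" "e1 \<bullet> fm = h"
    by (simp_all add: f0_def fm_def bracket_scale_right)
qed

lemma e0_e1: "e0 \<bullet> e1 = 0"
proof -
  have "y k j \<bullet> y j l = 2 *s y k j + 2 *s y j l"
    using ijkl by (auto intro: triangle)
  moreover have "y k j = - y j k"
    using ijkl by (auto intro: y_flip)
  ultimately have "- (y j k \<bullet> y j l) = - (2 *s y j k) + 2 *s y j l"
    by simp
  then have "y j k \<bullet> y j l = 2 *s y j k - 2 *s y j l"
    by (metis minus_diff_eq minus_minus uminus_add_conv_diff)
  then show ?thesis
    using ijkl by (simp add: e0_def e1_def bracket_simps bracket_self h_y y_h)
qed

lemma f0_fm: "f0 \<bullet> fm = 0"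
proof -
  have "y k i \<bullet> y i l = 2 *s y k i + 2 *s y i l"
    using ijkl by (auto intro: triangle)
  moreover have "y i l = - y l i"
    using ijkl by (auto intro: y_flip)
  ultimately have "- (y k i \<bullet> y l i) = 2 *s y k i - 2 *s y l i"
    by simp
  then have "y k i \<bullet> y l i = 2 *s y l i - 2 *s y k i"
    by (metis minus_diff_eq minus_minus)
  then show ?thesis
    using ijkl by (simp add: f0_def fm_def bracket_simps bracket_self h_y y_h
        scale_right_distrib scale_right_diff_distrib)
qed

lemma c_decomposition: "c = c0 + cp + cm"
proof -
  have "8 *s (cp + cm) = 2 *s (h \<bullet> h \<bullet> c)"
    by (simp add: cp_def cm_def scale_right_distrib scale_right_diff_distrib double)
  then have "(1 / 8) *s 8 *s (cp + cm) = (1 / 8) *s 2 *s (h \<bullet> h \<bullet> c)"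
    by (rule arg_cong)
  then show ?thesis by (simp add: c0_def add.assoc)
qed

lemma hhhc: "h \<bullet> h \<bullet> h \<bullet> c = 4 *s (h \<bullet> c)"
  unfolding h_def c_def by (rule dolan_grady) (rule ijkl)

lemma h_c0: "h \<bullet> c0 = 0" and h_cp: "h \<bullet> cp = 2 *s cp" and h_cm: "h \<bullet> cm = - (2 *s cm)"
  by (simp_all add: c0_def cp_def cm_def bracket_simps hhhc scale_right_distrib
      scale_right_diff_distrib add.commute)

lemma bracket_weights:
  assumes "h \<bullet> u = a *s u" "h \<bullet> v = b *s v"
  shows "h \<bullet> u \<bullet> v = (a + b) *s (u \<bullet> v)"
  by (simp add: bracket_left_comm[of h] assms bracket_simps scale_left_distrib)

lemma weights_zero:
  assumes "h \<bullet> u = a *s u" "h \<bullet> v = b *s v" "h \<bullet> w = d *s w"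
    and "u + v + w = 0" "a \<noteq> b" "a \<noteq> d" "b \<noteq> d"
  shows "u = 0" "v = 0" "w = 0"
  using linear_operator.eigenvectors_sum_zero_3[OF linear_bracket assms(1-3) assms(5-7) assms(4)] .

text \<open>The sign \<open>s\<close> is \<open>1\<close> for \<open>a = k\<close> and \<open>-1\<close> for \<open>a = l\<close>.\<close>

lemma y_j_c:
  assumes e: "e = h + y j a" "h \<bullet> e = 2 *s e" and s: "y j a \<bullet> s *s c = 2 *s y j a + 2 *s s *s c" "s * s = 1"
  shows "e \<bullet> cp = 0" "e \<bullet> c0 = (2 * s) *s e + 4 *s cp" "e \<bullet> cm = 2 *s c0 - (2 * s) *s h"
proof -
  have e0: "e \<bullet> h = - (2 *s e)"
    using e(2) bracket_commute[of e h] by simp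
  have hcp: "h \<bullet> cp = 2 *s cp" and hcm: "h \<bullet> cm = (- 2) *s cm" and hc0: "h \<bullet> c0 = 0 *s c0"
    by (simp_all add: h_cp h_cm h_c0)
  have s': "s *s s *s x = x" for x
    using s(2) by simp
  have "(e - h) \<bullet> c = s *s s *s ((e - h) \<bullet> c)"
    by (simp only: s')
  also have "\<dots> = s *s (2 *s (e - h) + 2 *s s *s c)"
    using s(1) by (simp add: e(1) bracket_scale_right)
  also have "\<dots> = (2 * s) *s e - (2 * s) *s h + 2 *s c"
    using s(2) by (simp add: scale_right_distrib scale_right_diff_distrib mult.commute mult.left_commute)
  \<comment> \<open>The three summands have weights 4, 2 and 0 for \<open>h\<close>, so each of them
    vanishes.\<close>
  finally have "e \<bullet> cp + (e \<bullet> c0 - (2 * s) *s e - 4 *s cp) + (e \<bullet> cm - 2 *s c0 + (2 * s) *s h) = 0"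
    unfolding c_decomposition
    by (simp add: bracket_simps h_c0 h_cp h_cm scale_right_distrib quadruple double algebra_simps)
  note weights_zero[OF bracket_weights[OF e(2) hcp] _ _ this, of 2 0]
  moreover have "h \<bullet> (e \<bullet> c0 - (2 * s) *s e - 4 *s cp) = 2 *s (e \<bullet> c0 - (2 * s) *s e - 4 *s cp)"
    using bracket_weights[OF e(2) hc0]
    by (simp add: bracket_diff_right bracket_scale_right hcp e(2) scale_right_diff_distrib mult.commute)
  moreover have "h \<bullet> (e \<bullet> cm - 2 *s c0 + (2 * s) *s h) = 0 *s (e \<bullet> cm - 2 *s c0 + (2 * s) *s h)"
    using bracket_weights[OF e(2) hcm]
    by (simp add: bracket_simps h_c0 bracket_self)
  ultimately have "e \<bullet> cp = 0" "e \<bullet> c0 - (2 * s) *s e - 4 *s cp = 0" "e \<bullet> cm - 2 *s c0 + (2 * s) *s h = 0"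
    by simp_all
  then show "e \<bullet> cp = 0" "e \<bullet> c0 = (2 * s) *s e + 4 *s cp" "e \<bullet> cm = 2 *s c0 - (2 * s) *s h"
    by (simp_all add: algebra_simps)
qed

text \<open>These are the parts of weight -4, -2 and 0 of the triangle relation of
  \<open>x_ik\<close> and \<open>x_kl\<close>, with \<open>x_ik = h + 4 f0\<close>.\<close>

lemma f0_c: "f0 \<bullet> cm = 0" "f0 \<bullet> c0 = 2 *s f0 + cm" "f0 \<bullet> cp = (1 / 2) *s (h + c0)"
proof -
  have hcp: "h \<bullet> cp = 2 *s cp" and hcm: "h \<bullet> cm = (- 2) *s cm" and hc0: "h \<bullet> c0 = 0 *s c0"
    and hf: "h \<bullet> f0 = (- 2) *s f0"
    by (simp_all add: h_cp h_cm h_c0 h_f0)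
  have "y i k \<bullet> c = 2 *s y i k + 2 *s c"
    unfolding c_def using ijkl by (auto intro: triangle)
  moreover have "y i k = h + 4 *s f0"
    using ijkl y_flip[of i k] by (simp add: f0_def)
  ultimately have "(h + 4 *s f0) \<bullet> c = 2 *s (h + 4 *s f0) + 2 *s c" by simp
  then have "4 *s (f0 \<bullet> cm) + 4 *s (f0 \<bullet> c0 - 2 *s f0 - cm) + (4 *s (f0 \<bullet> cp) - 2 *s (h + c0)) = 0"
    unfolding c_decomposition
    by (simp add: bracket_simps h_c0 h_cp h_cm scale_right_distrib quadruple double algebra_simps)
  note weights_zero[OF _ _ _ this, of "-4" "-2" 0]
  moreover have "h \<bullet> 4 *s (f0 \<bullet> cm) = (- 4) *s 4 *s (f0 \<bullet> cm)"
    using bracket_weights[OF hf hcm] by (simp add: bracket_scale_right)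
  moreover have "h \<bullet> 4 *s (f0 \<bullet> c0 - 2 *s f0 - cm) = (- 2) *s 4 *s (f0 \<bullet> c0 - 2 *s f0 - cm)"
    using bracket_weights[OF hf hc0]
    by (simp add: bracket_diff_right bracket_scale_right hcm hf scale_right_diff_distrib)
  moreover have "h \<bullet> (4 *s (f0 \<bullet> cp) - 2 *s (h + c0)) = 0 *s (4 *s (f0 \<bullet> cp) - 2 *s (h + c0))"
    using bracket_weights[OF hf hcp] by (simp add: bracket_simps h_c0 bracket_self)
  ultimately have *: "4 *s (f0 \<bullet> cm) = 0" "4 *s (f0 \<bullet> c0 - 2 *s f0 - cm) = 0"
    "4 *s (f0 \<bullet> cp) = 2 *s (h + c0)"
    by simp_all
  from *(1) show "f0 \<bullet> cm = 0" by simp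
  have "f0 \<bullet> c0 - 2 *s f0 - cm = 0"
    using *(2) by (subst (asm) scale_eq_0_iff) simp
  then show "f0 \<bullet> c0 = 2 *s f0 + cm"
    by (simp add: algebra_simps)
  have "f0 \<bullet> cp = (1 / 4) *s 4 *s (f0 \<bullet> cp)" by simp
  then show "f0 \<bullet> cp = (1 / 2) *s (h + c0)" unfolding *(3) by simp
qed

sublocale tetrahedron_loop scale bracket h e0 e1 f0 fm c0 cp cm
proof -
  have "y j k \<bullet> 1 *s c = 2 *s y j k + 2 *s 1 *s c"
    unfolding c_def using ijkl by (auto intro: triangle)
  note e0 = y_j_c[OF e0_def h_e0 this]
  have "y l k = - y k l"
    using ijkl y_flip[of l k] by auto
  moreover have "y j l \<bullet> y l k = 2 *s y j l + 2 *s y l k"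
    using ijkl by (auto intro: triangle)
  ultimately have "y j l \<bullet> (-1) *s c = 2 *s y j l + 2 *s (-1) *s c"
    unfolding c_def by simp
  note e1 = y_j_c[OF e1_def h_e1 this]
  show "tetrahedron_loop scale bracket h e0 e1 f0 fm c0 cp cm"
    by unfold_locales
      (use e0 e1 in \<open>simp_all add: h_e0 h_e1 h_f0 h_fm e0_f0 e1_fm e0_e1 f0_fm f0_c\<close>)
qed

end

section \<open>Endomorphisms of a finite-dimensional vector space\<close>

lemma sum_fun_apply: "(\<Sum>i\<in>A. f i) x = (\<Sum>i\<in>A. f i x)"
  by (induction A rule: infinite_finite_induct) simp_all

locale operator_algebra = finite_dimensional_vector_space scale Basis
  for scale :: "'f::field_char_0 \<Rightarrow> 'v::ab_group_add \<Rightarrow> 'v" (infixr "*s" 75) and Basis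
begin

abbreviation "linop \<equiv> Vector_Spaces.linear scale scale"

definition op_scale :: "'f \<Rightarrow> ('v \<Rightarrow> 'v) \<Rightarrow> 'v \<Rightarrow> 'v"
  where "op_scale c A v = c *s A v"

text \<open>
  The linear map that agrees with \<open>A\<close> on the basis. It makes the commutator a Lie bracket on
  the whole type of functions.
\<close>

definition linearize :: "('v \<Rightarrow> 'v) \<Rightarrow> 'v \<Rightarrow> 'v"
  where "linearize A v = (\<Sum>b\<in>Basis. representation Basis v b *s A b)"

definition comm :: "('v \<Rightarrow> 'v) \<Rightarrow> ('v \<Rightarrow> 'v) \<Rightarrow> 'v \<Rightarrow> 'v"
  where "comm A B v = linearize A (linearize B v) - linearize B (linearize A v)"

lemma linop_linearize: "linop (linearize A)"
  using span_Basis
  by unfold_locales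
    (simp_all add: linearize_def representation_add representation_scale independent_Basis
      scale_left_distrib sum.distrib scale_sum_right)

lemma linearize_linop:
  assumes "linop A"
  shows "linearize A = A"
proof
  fix v
  interpret A: Vector_Spaces.linear scale scale A by fact
  have "A v = A (\<Sum>b\<in>Basis. representation Basis v b *s b)"
    using span_Basis finite_Basis by (simp add: sum_representation_eq independent_Basis)
  then show "linearize A v = A v"
    by (simp add: linearize_def A.sum_scale)
qed

lemma comm_linop: "linop A \<Longrightarrow> linop B \<Longrightarrow> comm A B v = A (B v) - B (A v)"
  by (simp add: comm_def linearize_linop)

lemma linop_comm: "linop (comm A B)"
proof -
  interpret A: Vector_Spaces.linear scale scale "linearize A" by (rule linop_linearize)
  interpret B: Vector_Spaces.linear scale scale "linearize B" by (rule linop_linearize)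
  show ?thesis
    by unfold_locales (simp_all add: comm_def A.add B.add A.scale B.scale scale_right_diff_distrib)
qed

lemma linearize_add: "linearize (A + B) v = linearize A v + linearize B v"
  by (simp add: linearize_def scale_right_distrib sum.distrib)

lemma linearize_op_scale: "linearize (op_scale c A) v = c *s linearize A v"
  by (simp add: linearize_def op_scale_def scale_sum_right mult.commute)

sublocale Op: lie_algebra op_scale comm
proof
  fix A B C :: "'v \<Rightarrow> 'v" and c d :: 'f
  interpret A: Vector_Spaces.linear scale scale "linearize A" by (rule linop_linearize)
  interpret B: Vector_Spaces.linear scale scale "linearize B" by (rule linop_linearize)
  interpret C: Vector_Spaces.linear scale scale "linearize C" by (rule linop_linearize)
  show "op_scale c (A + B) = op_scale c A + op_scale c B"
    by (rule ext) (simp add: op_scale_def scale_right_distrib)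
  show "op_scale (c + d) A = op_scale c A + op_scale d A"
    by (rule ext) (simp add: op_scale_def scale_left_distrib)
  show "op_scale c (op_scale d A) = op_scale (c * d) A" "op_scale 1 A = A"
    by (rule ext, simp add: op_scale_def)+
  show "comm (A + B) C = comm A C + comm B C" "comm A (B + C) = comm A B + comm A C"
    by (rule ext, simp add: comm_def linearize_add A.add B.add C.add)+
  show "comm (op_scale c A) B = op_scale c (comm A B)" "comm A (op_scale c B) = op_scale c (comm A B)"
    by (rule ext, simp add: comm_def linearize_op_scale op_scale_def A.scale B.scale scale_right_diff_distrib)+
  show "comm A A = 0"
    by (rule ext) (simp add: comm_def)
  have "linearize (comm A' B') v = comm A' B' v" for A' B' v
    by (simp add: linearize_linop linop_comm)
  then have *: "comm A' (comm B' C') v = linearize A' (comm B' C' v) - comm B' C' (linearize A' v)" for A' B' C' v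
    unfolding comm_def[of A' "comm B' C'"] by simp
  show "comm A (comm B C) + comm B (comm C A) + comm C (comm A B) = 0"
    by (rule ext) (simp add: *, simp add: comm_def A.diff B.diff C.diff)
qed

text \<open>The spanning set consists of the matrix units of \<open>Basis\<close>.\<close>

lemma linop_in_span:
  assumes "linop A"
  shows "A \<in> Op.span ((\<lambda>(b, b') v. representation Basis v b *s b') ` (Basis \<times> Basis))"
    (is "_ \<in> Op.span ?S")
proof -
  define e where "e b b' v = representation Basis v b *s b'" for b b' v
  have "A v = (\<Sum>b\<in>Basis. \<Sum>b'\<in>Basis. op_scale (representation Basis (A b) b') (e b b')) v" for v
  proof -
    have "A v = (\<Sum>b\<in>Basis. representation Basis v b *s A b)"
      using linearize_linop[OF assms] by (metis linearize_def)
    also have "\<dots> = (\<Sum>b\<in>Basis. representation Basis v b *s (\<Sum>b'\<in>Basis. representation Basis (A b) b' *s b'))"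
      using span_Basis finite_Basis by (simp add: sum_representation_eq independent_Basis)
    also have "\<dots> = (\<Sum>b\<in>Basis. \<Sum>b'\<in>Basis. op_scale (representation Basis (A b) b') (e b b')) v"
      by (simp add: sum_fun_apply op_scale_def e_def scale_sum_right mult.commute)
    finally show ?thesis .
  qed
  then have "A = (\<Sum>b\<in>Basis. \<Sum>b'\<in>Basis. op_scale (representation Basis (A b) b') (e b b'))" by blast
  moreover have "e b b' \<in> ?S" if "b \<in> Basis" "b' \<in> Basis" for b b'
    using that by (intro image_eqI[of _ _ "(b, b')"]) (simp_all add: e_def fun_eq_iff)
  then have "(\<Sum>b\<in>Basis. \<Sum>b'\<in>Basis. op_scale (representation Basis (A b) b') (e b b')) \<in> Op.span ?S"
    by (intro Op.span_sum Op.span_scale Op.span_base)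
  ultimately show ?thesis by simp
qed

sublocale Op: fd_lie_algebra op_scale comm
proof
  show "\<exists>t. finite t \<and> (\<forall>A B. comm A B \<in> Op.span t)"
    by (rule exI, rule conjI[rotated], intro allI, rule linop_in_span[OF linop_comm])
      (simp add: finite_Basis)
qed

end

context operator_algebra
begin

lemma
  assumes "linop A"
  shows linop_add: "A (x + y) = A x + A y" and linop_scale: "A (c *s x) = c *s A x"
    and linop_zero: "A 0 = 0" and linop_diff: "A (x - y) = A x - A y" and linop_minus: "A (- x) = - A x"
proof -
  interpret A: Vector_Spaces.linear scale scale A by fact
  show "A (x + y) = A x + A y" "A (c *s x) = c *s A x" "A 0 = 0" "A (x - y) = A x - A y" "A (- x) = - A x"
    by (simp_all add: A.add A.scale A.zero A.diff A.neg)
qed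

lemma linop_op_scale:
  assumes "linop A"
  shows "linop (op_scale c A)"
proof -
  interpret A: Vector_Spaces.linear scale scale A by fact
  show ?thesis
    by unfold_locales (simp_all add: op_scale_def A.add A.scale scale_right_distrib mult.commute)
qed

end

section \<open>Irreducible modules of the tetrahedron algebra\<close>

locale tetrahedron_module =
  operator_algebra scale Basis + lie_module tet_scale tet_bracket scale act
  for scale :: "'f::{alg_closed_field, field_char_0} \<Rightarrow> 'v::ab_group_add \<Rightarrow> 'v" (infixr "*s" 75)
    and Basis and act :: "'f tetrahedron_algebra \<Rightarrow> 'v \<Rightarrow> 'v" +
  fixes i j k l :: 4 and \<sigma> :: "4 perm"
  assumes irreducible: irreducible_module
    and ijkl: "distinct [i, j, k, l]"
    and \<sigma>: "Perm.apply \<sigma> i = j" "Perm.apply \<sigma> j = i" "Perm.apply \<sigma> k = l" "Perm.apply \<sigma> l = k"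
begin

lemma linop_act: "linop (act x)"
  by unfold_locales (simp_all add: act_add_right act_scale_right)

lemma act_comm: "act (tet_bracket x y) = comm (act x) (act y)"
  by (rule ext) (simp add: act_bracket comm_linop linop_act)

lemma act_add: "act (x + y) = act x + act y"
  by (rule ext) (simp add: act_add_left)

lemma act_scale: "act (tet_scale c x) = op_scale c (act x)"
  by (rule ext) (simp add: act_scale_left op_scale_def)

lemma act_0: "act 0 = 0"
  using act_add[of 0 0] by simp

sublocale T: tetrahedron_elements op_scale comm "\<lambda>a b. act (tet_gen a b)" i j k l
proof
  show "act (tet_gen a b) + act (tet_gen b a) = 0" if "a \<noteq> b" for a b
    using tet_gen_skew[OF that, where 'a = 'f] act_0 by (simp flip: act_add)
  show "comm (act (tet_gen a b)) (act (tet_gen b d)) =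
      op_scale 2 (act (tet_gen a b)) + op_scale 2 (act (tet_gen b d))" if "distinct [a, b, d]" for a b d
    using tet_gen_triangle[OF that, where 'a = 'f] by (simp flip: act_add act_scale act_comm)
  show "comm (act (tet_gen a b)) (comm (act (tet_gen a b)) (comm (act (tet_gen a b)) (act (tet_gen d e)))) =
      op_scale 4 (comm (act (tet_gen a b)) (act (tet_gen d e)))" if "distinct [a, b, d, e]" for a b d e
    using tet_gen_dolan_grady[OF that, where 'a = 'f] by (simp flip: act_scale act_comm)
qed (rule ijkl)

abbreviation "E \<equiv> T.E"
abbreviation "F \<equiv> T.F"
abbreviation "H \<equiv> T.H"

text \<open>An eigenvector of \<open>ad h\<close> with nonzero eigenvalue is a multiple of a
  commutator, and commutators are linear.\<close>

lemma linop_E: "linop (E n)"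
proof -
  have "E n = op_scale (1 / 2) (comm T.h (E n))"
    by (simp add: T.h_E)
  then show ?thesis by (metis linop_op_scale linop_comm)
qed

lemma linop_F: "linop (F n)"
proof -
  have "F n = op_scale (- 1 / 2) (comm T.h (F n))"
    by (simp add: T.h_F)
  then show ?thesis by (metis linop_op_scale linop_comm)
qed

lemma linop_H: "linop (H n)"
  by (simp add: T.H_def linop_comm)

lemmas linop_simps = linop_add linop_scale linop_zero linop_diff linop_minus
lemmas E_linear = linop_simps[OF linop_E]
lemmas F_linear = linop_simps[OF linop_F]
lemmas H_linear = linop_simps[OF linop_H]

lemma E_F: "E m (F n x) = F n (E m x) + H (m + n) x"
  using fun_cong[OF T.loop_relations(1)[of m n], of x] by (simp add: comm_linop linop_E linop_F algebra_simps)

lemma H_E: "H m (E n x) = E n (H m x) + 2 *s E (m + n) x"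
  using fun_cong[OF T.loop_relations(2)[of m n], of x]
  by (simp add: comm_linop linop_E linop_H op_scale_def algebra_simps)

lemma H_F: "H m (F n x) = F n (H m x) - 2 *s F (m + n) x"
  using fun_cong[OF T.loop_relations(3)[of m n], of x]
  by (simp add: comm_linop linop_F linop_H op_scale_def algebra_simps)

lemma H_H: "H m (H n x) = H n (H m x)"
  using fun_cong[OF T.H_H[of m n], of x] by (simp add: comm_linop linop_H)

lemma index_cases: "a = i \<or> a = j \<or> a = k \<or> a = l"
proof -
  have "card {i, j, k, l} = card (UNIV :: 4 set)"
    using ijkl by (simp add: card_insert_if)
  then have "{i, j, k, l} = UNIV"
    by (intro card_subset_eq) simp_all
  then show ?thesis by blast
qed

lemma tet_perm_involution: "tet_perm \<sigma> (tet_perm \<sigma> x) = x"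
proof -
  have "\<sigma> * \<sigma> = 1"
  proof (rule perm_eqI)
    show "Perm.apply (\<sigma> * \<sigma>) a = Perm.apply 1 a" for a
      using index_cases[of a] by (auto simp: apply_times \<sigma>)
  qed
  then show ?thesis
    by (simp add: tet_perm_one flip: tet_perm_mult)
qed

lemma tet_perm_hom:
  "tet_perm \<sigma> (x + y) = tet_perm \<sigma> x + tet_perm \<sigma> y" "tet_perm \<sigma> (0 :: 'f tetrahedron_algebra) = 0"
  "tet_perm \<sigma> (tet_scale c x) = tet_scale c (tet_perm \<sigma> x)"
  "tet_perm \<sigma> (tet_bracket x y) = tet_bracket (tet_perm \<sigma> x) (tet_perm \<sigma> y)"
  for x y :: "'f tetrahedron_algebra"
proof -
  interpret S: lie_algebra_hom tet_scale tet_bracket tet_scale tet_bracket "tet_perm \<sigma> :: 'f tetrahedron_algebra \<Rightarrow> _"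
    by (rule lie_algebra_hom_tet_perm)
  show "tet_perm \<sigma> (x + y) = tet_perm \<sigma> x + tet_perm \<sigma> y" "tet_perm \<sigma> (0 :: 'f tetrahedron_algebra) = 0"
    "tet_perm \<sigma> (tet_scale c x) = tet_scale c (tet_perm \<sigma> x)"
    "tet_perm \<sigma> (tet_bracket x y) = tet_bracket (tet_perm \<sigma> x) (tet_perm \<sigma> y)"
    for x y :: "'f tetrahedron_algebra"
    by (simp_all add: S.add S.zero S.scale S.hom_bracket)
qed

text \<open>Every generator acts as a linear combination of the \<open>E n\<close>,
  \<open>F n\<close> and \<open>H n\<close>, so a relation that holds on these and respects the
  operations holds between each element and its image under the antiautomorphism
  \<open>- tet_perm \<sigma>\<close>. An antiautomorphism reverses brackets, hence the order
  \<open>y' x'\<close>.\<close>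

lemma act_adjoint_induct:
  assumes E: "\<And>n. Q (E n) (- op_scale 4 (F (n - 1)))"
    and F: "\<And>n. Q (F n) (op_scale (- 1 / 4) (E (n + 1)))"
    and H: "\<And>n. Q (H n) (H n)"
    and add: "\<And>A A' B B'. Q A A' \<Longrightarrow> Q B B' \<Longrightarrow> Q (A + B) (A' + B')"
    and scale: "\<And>A A' c. Q A A' \<Longrightarrow> Q (op_scale c A) (op_scale c A')"
    and comm: "\<And>x x' y y'. Q (act x) (act x') \<Longrightarrow> Q (act y) (act y') \<Longrightarrow>
      Q (act (tet_bracket x y)) (act (tet_bracket y' x'))"
  shows "Q (act x) (act (- tet_perm \<sigma> x))"
proof (induction x rule: tet_induct)
  have minus: "Q (- A) (- A')" if "Q A A'" for A A'
    using scale[OF that, of "- 1"] by simp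
  have diff: "Q (A - B) (A' - B')" if "Q A A'" "Q B B'" for A A' B B'
    using add[OF that(1) minus[OF that(2)]] by simp
  have zero: "Q 0 0"
    using scale[OF H, of 0 0] by simp
  have sum: "Q (\<Sum>i\<in>S. op_scale (c i) (A i)) (\<Sum>i\<in>S. op_scale (c i) (A' i))"
    if "\<And>i. Q (A i) (A' i)" for c :: "nat \<Rightarrow> 'f" and S A A'
  proof (induction S rule: infinite_finite_induct)
    case (insert x S)
    show ?case
      unfolding sum.insert[OF insert.hyps] by (intro add scale that insert.IH)
  next
    case (infinite S)
    show ?case
      unfolding sum.infinite[OF infinite] by (rule zero)
  next
    case empty
    show ?case
      unfolding sum.empty by (rule zero)
  qed
  {
    case zero
    show ?case
      unfolding tet_perm_hom minus_zero act_0 by (rule \<open>Q 0 0\<close>)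
  next
    case (plus x y)
    then show ?case
      using add[OF plus] by (simp add: tet_perm_hom add.commute flip: act_add)
  next
    case (scale c x)
    then show ?case
      using assms(5)[OF scale, of c]
      by (simp add: tet_perm_hom flip: act_scale)
  next
    case (bracket x y)
    have "tet_bracket (- tet_perm \<sigma> y) (- tet_perm \<sigma> x) = - tet_perm \<sigma> (tet_bracket x y)"
      by (simp add: tet_perm_hom tet.bracket_commute[of "tet_perm \<sigma> y"])
    then show ?case using comm[OF bracket] by simp
  next
    case (gen a b)
    define R where "R a b \<longleftrightarrow> Q (act (tet_gen a b)) (act (- tet_perm \<sigma> (tet_gen a b)))" for a b
    have act_minus: "act (- x) = - act x" for x
      using act_scale[of "-1" x] by simp
    have gen_minus: "tet_gen a b = - (tet_gen b a :: 'f tetrahedron_algebra)" if "a \<noteq> b" for a b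
      using tet_gen_skew[OF that] by (simp add: eq_neg_iff_add_eq_0)
    have flip: "R b a" if "a \<noteq> b" "R a b" for a b
    proof -
      have "tet_gen b a = - (tet_gen a b :: 'f tetrahedron_algebra)"
        by (rule gen_minus) (use that(1) in simp)
      then show ?thesis
        using minus[OF that(2)[unfolded R_def]] tet_perm_hom(3)[of "-1" "tet_gen a b"]
        by (simp add: R_def act_minus)
    qed
    have h: "act (tet_gen i j) = H 0"
      by (simp add: T.H_0 T.h_def)
    have jk: "act (tet_gen j k) = E 0 - H 0" and jl: "act (tet_gen j l) = E 1 - H 0"
      unfolding T.E_0 T.E_1 T.H_0 by (simp_all add: T.e0_def T.e1_def)
    have ki: "act (tet_gen k i) = - op_scale 4 (F 0) - H 0" and li: "act (tet_gen l i) = - op_scale 4 (F (- 1)) - H 0"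
      unfolding T.F_0 T.F_m1 T.H_0 by (simp_all add: T.f0_def T.fm_def)
    have "Q T.c T.c"
    proof -
      obtain m \<gamma> where \<gamma>: "T.cp = (\<Sum>n\<le>m. op_scale (\<gamma> n) (E (int n + 1)))"
        "T.cm = (\<Sum>n\<le>m. op_scale (\<gamma> n) (- op_scale 4 (F (int n))))"
        "T.c0 = (\<Sum>n\<le>m. op_scale (\<gamma> n) (- op_scale 2 (H (int n + 1)))) - T.h"
        using T.c_in_loop_algebra .
      \<comment> \<open>The summands \<open>E (n + 1)\<close> and \<open>- 4 F n\<close> correspond
        term by term, with equal coefficients.\<close>
      have "Q T.cp T.cm"
        unfolding \<gamma> by (rule sum) (use E[of "int _ + 1"] in simp)
      moreover have "Q T.cm T.cp"
        unfolding \<gamma>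
      proof (rule sum)
        show "Q (- op_scale 4 (F (int n))) (E (int n + 1))" for n
          using minus[OF assms(5)[OF F[of "int n"], of 4]] by simp
      qed
      moreover have "Q T.c0 T.c0"
        unfolding \<gamma> T.H_0[symmetric] by (intro diff sum minus assms(5) H)
      ultimately have "Q (T.c0 + T.cp + T.cm) (T.c0 + T.cm + T.cp)"
        by (intro add)
      then show ?thesis
        by (simp add: T.c_decomposition add_ac)
    qed
    \<comment> \<open>Since \<open>\<sigma>\<close> sends \<open>x_kl\<close> to
      \<open>x_lk = - x_kl\<close>, the antiautomorphism fixes \<open>x_kl\<close>.\<close>
    then have kl': "R k l"
      using gen_minus[of l k] by (simp add: R_def tet_perm_gen \<sigma> T.c_def)
    have ij': "R i j"
      using gen_minus[of j i] H[of 0] by (simp add: R_def tet_perm_gen \<sigma> h)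
    have jk': "R j k"
      using gen_minus[of i l] diff[OF E[of 0] H[of 0]] by (simp add: R_def tet_perm_gen \<sigma> jk li)
    have jl': "R j l"
      using gen_minus[of i k] diff[OF E[of 1] H[of 0]] by (simp add: R_def tet_perm_gen \<sigma> jl ki)
    have ki': "R k i"
      using gen_minus[of l j] diff[OF minus[OF assms(5)[OF F[of 0], of 4]] H[of 0]]
      by (simp add: R_def tet_perm_gen \<sigma> jl ki)
    have li': "R l i"
      using gen_minus[of k j] diff[OF minus[OF assms(5)[OF F[of "- 1"], of 4]] H[of 0]]
      by (simp add: R_def tet_perm_gen \<sigma> jk li)
    have "R a b"
      using index_cases[of a] index_cases[of b] gen flip kl' ij' jk' jl' ki' li' by metis
    then show ?case by (simp add: R_def)
  }
qed

text \<open>The induction is used with a relation that ignores its second argument.\<close>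

lemma submoduleI:
  assumes "subspace W"
    and "\<And>n x. x \<in> W \<Longrightarrow> E n x \<in> W" "\<And>n x. x \<in> W \<Longrightarrow> F n x \<in> W" "\<And>n x. x \<in> W \<Longrightarrow> H n x \<in> W"
  shows "submodule W"
proof -
  have "\<forall>w\<in>W. act x w \<in> W" for x
    using act_adjoint_induct[of "\<lambda>A A'. \<forall>w\<in>W. A w \<in> W" x] assms
    by (simp add: op_scale_def subspace_add subspace_scale act_bracket subspace_diff)
  with assms(1) show ?thesis by (simp add: submodule_def)
qed

lemma submodule_eq_UNIV: "submodule W \<Longrightarrow> x \<in> W \<Longrightarrow> x \<noteq> 0 \<Longrightarrow> W = UNIV"
  using irreducible unfolding irreducible_module_def by blast


section \<open>Existence of a highest weight vector\<close>

lemma linear_operator_H: "linear_operator scale (H n)"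
  by (intro linear_operator.intro linear_operator_axioms.intro vector_space_axioms linop_H)

text \<open>Raising an eigenvalue by 2 must stop, since infinitely many distinct eigenvalues are
  impossible in finite dimension.\<close>

lemma ex_maximal_eigenvalue:
  obtains v \<theta> where "v \<noteq> 0" "H 0 v = \<theta> *s v" "\<And>w. H 0 w = (\<theta> + 2) *s w \<Longrightarrow> w = 0"
proof -
  interpret H0: linear_operator scale "H 0" by (rule linear_operator_H)
  obtain x :: 'v where "x \<noteq> 0"
    using irreducible unfolding irreducible_module_def by blast
  then obtain y r where y: "y \<noteq> 0" "H 0 y = r *s y"
    using ex_eigenvector[OF linear_operator_H finite_Basis, of UNIV 0 x] span_Basis by auto
  define P where "P n \<longleftrightarrow> (\<exists>w. w \<noteq> 0 \<and> H 0 w = (r + 2 * of_nat n) *s w)" for n :: nat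
  have "P 0" using y by (auto simp: P_def)
  have "\<exists>n. P n \<and> \<not> P (Suc n)"
  proof (rule ccontr)
    assume "\<nexists>n. P n \<and> \<not> P (Suc n)"
    with \<open>P 0\<close> have "P n" for n by (induction n) auto
    then obtain w where w: "\<And>n. w n \<noteq> 0" "\<And>n. H 0 (w n) = (r + 2 * of_nat n) *s w n"
      unfolding P_def by metis
    have "\<exists>n. w n = 0"
      by (rule H0.infinitely_many_eigenvalues[OF finite_Basis _ w(2)]) (auto simp: span_Basis inj_def)
    with w(1) show False by blast
  qed
  then obtain n w where "w \<noteq> 0" "H 0 w = (r + 2 * of_nat n) *s w" "\<not> P (Suc n)"
    unfolding P_def by blast
  with that[of w "r + 2 * of_nat n"] show ?thesis
    by (auto simp: P_def algebra_simps)
qed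

text \<open>Take a nonzero subspace of the \<open>\<theta>\<close>-eigenspace of \<open>H 0\<close>
  that is stable under all \<open>H n\<close> and of least dimension. As the \<open>H n\<close>
  commute, an eigenspace of one of them inside it is stable again, so each \<open>H n\<close> is
  scalar there. Each \<open>E n\<close> raises the eigenvalue of \<open>H 0\<close> by 2 and so
  kills the subspace by maximality.\<close>

lemma ex_highest_weight_vector:
  obtains v wt where "v \<noteq> 0" "\<And>n. E n v = 0" "\<And>n. H n v = wt n *s v"
    "\<And>w. H 0 w = (wt 0 + 2) *s w \<Longrightarrow> w = 0"
proof -
  obtain v0 \<theta> where v0: "v0 \<noteq> 0" "H 0 v0 = \<theta> *s v0" and max: "\<And>w. H 0 w = (\<theta> + 2) *s w \<Longrightarrow> w = 0"
    by (rule ex_maximal_eigenvalue) blast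
  define good where "good W \<longleftrightarrow> subspace W \<and> (\<exists>x\<in>W. x \<noteq> 0) \<and> (\<forall>x\<in>W. H 0 x = \<theta> *s x) \<and>
    (\<forall>n. \<forall>x\<in>W. H n x \<in> W)" for W
  have "good {x. H 0 x = \<theta> *s x}"
    unfolding good_def
    using v0 by (auto intro!: subspaceI simp: H_linear scale_right_distrib mult.commute H_H[of 0])
  from ex_has_least_nat[of good _ dim, OF this]
  obtain W where W: "good W" and least: "\<And>W'. good W' \<Longrightarrow> dim W \<le> dim W'"
    by blast
  have "\<exists>r. \<forall>x\<in>W. H n x = r *s x" for n
  proof -
    obtain x where "x \<in> W" "x \<noteq> 0" using W by (auto simp: good_def)
    then obtain y r where y: "y \<in> W" "y \<noteq> 0" "H n y = r *s y"
      using ex_eigenvector[OF linear_operator_H finite_Basis, of W n x] W span_Basis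
      by (auto simp: good_def)
    define W' where "W' = {x \<in> W. H n x = r *s x}"
    have "good W'"
      using W y unfolding good_def W'_def
      by (auto intro!: subspaceI simp: H_linear scale_right_distrib mult.commute H_H[of n]
          subspace_0 subspace_add subspace_scale)
    then have "W' = W"
      using W least by (intro subspace_dim_equal) (auto simp: good_def W'_def)
    then show ?thesis by (auto simp: W'_def)
  qed
  then obtain wt where wt: "\<And>n x. x \<in> W \<Longrightarrow> H n x = wt n *s x" by metis
  obtain v where v: "v \<in> W" "v \<noteq> 0" using W by (auto simp: good_def)
  have "(wt 0 - \<theta>) *s v = 0"
    using W v wt[of v 0] by (simp add: good_def scale_left_diff_distrib)
  then have \<theta>: "\<theta> = wt 0" using v by simp
  show ?thesis
  proof (rule that[OF v(2)])
    show "H n v = wt n *s v" for n by (rule wt[OF v(1)])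
    show "w = 0" if "H 0 w = (wt 0 + 2) *s w" for w using that max by (simp add: \<theta>)
    show "E n v = 0" for n
      by (rule max) (simp add: H_E wt v E_linear \<theta> scale_left_distrib)
  qed
qed

end

section \<open>Highest weight vectors and the twisted form\<close>

locale highest_weight_module = tetrahedron_module scale Basis act i j k l \<sigma>
  for scale :: "'f::{alg_closed_field, field_char_0} \<Rightarrow> 'v::ab_group_add \<Rightarrow> 'v" (infixr "*s" 75)
    and Basis act i j k l \<sigma> +
  fixes v :: 'v and wt :: "int \<Rightarrow> 'f"
  assumes v: "v \<noteq> 0" and E_v: "E n v = 0" and H_v: "H n v = wt n *s v"
    and wt_max: "H 0 w = (wt 0 + 2) *s w \<Longrightarrow> w = 0"
begin

section \<open>The module as the sum of the line of \<open>v\<close> and the images of the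
  \<open>F n\<close>\<close>

definition lower :: "'v set" where "lower = span (\<Union>n. range (F n))"

lemma subspace_lower: "subspace lower"
  by (simp add: lower_def)

lemma F_in_lower: "F n x \<in> lower"
  unfolding lower_def by (rule span_base) blast

lemma lower_induct [consumes 1]:
  assumes "x \<in> lower" "subspace {x. P x}" "\<And>n x. P (F n x)"
  shows "P x"
  using assms(1) unfolding lower_def
  by (induction rule: span_induct) (use assms in auto)

text \<open>Monomials in the \<open>F n\<close> applied to \<open>v\<close>. Their span absorbs
  \<open>H n\<close> and \<open>E n\<close>, which can be commuted to the right until they reach
  \<open>v\<close>; so it is a submodule.\<close>

inductive_set words :: "'v set" where
  base: "v \<in> words"
| step: "x \<in> words \<Longrightarrow> F n x \<in> words"

lemma in_span_words_linop:
  assumes "x \<in> span words" "linop A" "\<And>x. x \<in> words \<Longrightarrow> A x \<in> span words"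
  shows "A x \<in> span words"
proof -
  have "subspace {x. A x \<in> span words}"
    using assms(2) by (intro subspaceI) (simp_all add: linop_simps span_zero span_add span_scale)
  from span_induct[OF assms(1) this assms(3)] show ?thesis by simp
qed

lemma F_words: "x \<in> span words \<Longrightarrow> F n x \<in> span words"
  by (erule in_span_words_linop[OF _ linop_F]) (intro span_base words.step)

lemma H_words: "x \<in> span words \<Longrightarrow> H n x \<in> span words"
proof (erule in_span_words_linop[OF _ linop_H])
  show "H n x \<in> span words" if "x \<in> words" for x
    using that
  proof (induction arbitrary: n)
    case base
    show ?case by (simp add: H_v span_scale span_base words.base)
  next
    case (step x m)
    then show ?case
      by (simp add: H_F span_diff span_scale F_words span_base words.step)
  qed
qed

lemma E_words: "x \<in> span words \<Longrightarrow> E n x \<in> span words"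
proof (erule in_span_words_linop[OF _ linop_E])
  show "E n x \<in> span words" if "x \<in> words" for x
    using that
  proof (induction arbitrary: n)
    case base
    show ?case by (simp add: E_v span_zero)
  next
    case (step x m)
    then show ?case
      by (simp add: E_F span_add F_words H_words span_base)
  qed
qed

lemma span_words: "span words = UNIV"
  by (rule submodule_eq_UNIV[OF submoduleI _ v])
    (simp_all add: E_words F_words H_words span_base words.base)

lemma decompose:
  obtains c w where "w \<in> lower" "x = c *s v + w"
proof -
  have "words \<subseteq> span (insert v lower)"
  proof
    show "x \<in> span (insert v lower)" if "x \<in> words" for x
      using that by cases (auto intro: span_base F_in_lower)
  qed
  then have "x \<in> span (insert v lower)"
    using span_words span_minimal[of words "span (insert v lower)"] by auto
  moreover have "span lower = lower"
    using subspace_lower by (rule iffD2[OF span_eq_iff])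
  ultimately obtain c where "x - c *s v \<in> lower"
    by (auto simp: span_insert)
  then show ?thesis using that[of "x - c *s v" c] by simp
qed

text \<open>\<open>(H 0 - wt 0) (F n) = (F n) (H 0 - wt 0 - 2)\<close>, and the last factor is bijective by \<open>wt_max\<close>.\<close>

lemma shifted_range:
  assumes "x \<in> lower"
  obtains y where "x = H 0 y - wt 0 *s y"
proof -
  define S where "S y = H 0 y - (wt 0 + 2) *s y" for y
  have lin: "linop S"
    by unfold_locales (simp_all add: S_def H_linear scale_right_distrib scale_right_diff_distrib mult.commute)
  have "inj S"
    using wt_max by (subst module_hom.inj_iff_eq_0[OF module_hom_linearI[OF lin]]) (simp add: S_def)
  then have "surj S" by (rule linear_inj_imp_surj[OF lin])
  have "\<exists>y. x = H 0 y - wt 0 *s y"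
    using assms
  proof (induction rule: lower_induct)
    case 1
    show ?case
    proof (rule subspaceI; clarify)
      show "\<exists>y. 0 = H 0 y - wt 0 *s y" by (rule exI[of _ 0]) (simp add: H_linear)
      show "\<exists>y. H 0 a - wt 0 *s a + (H 0 b - wt 0 *s b) = H 0 y - wt 0 *s y" for a b
        by (rule exI[of _ "a + b"]) (simp add: H_linear scale_right_distrib)
      show "\<exists>y. c *s (H 0 a - wt 0 *s a) = H 0 y - wt 0 *s y" for c a
        by (rule exI[of _ "c *s a"]) (simp add: H_linear scale_right_diff_distrib mult.commute)
    qed
  next
    case (2 n x)
    obtain y where "x = S y" using \<open>surj S\<close> by (metis surjD)
    then have "F n x = H 0 (F n y) - wt 0 *s F n y"
      by (simp add: S_def H_F F_linear scale_left_distrib)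
    then show ?case by blast
  qed
  then show ?thesis using that by blast
qed

text \<open>Otherwise \<open>lower\<close> would be the whole module, and \<open>H 0 - wt 0\<close>
  would be surjective, hence injective in finite dimension, although it kills
  \<open>v\<close>.\<close>

lemma v_notin_lower: "v \<notin> lower"
proof
  assume "v \<in> lower"
  have lower: "x \<in> lower" for x
  proof -
    obtain c w where "w \<in> lower" "x = c *s v + w" by (rule decompose)
    then show ?thesis
      using \<open>v \<in> lower\<close> subspace_lower by (simp add: subspace_add subspace_scale)
  qed
  have "\<exists>y. x = H 0 y - wt 0 *s y" for x
    by (rule shifted_range[OF lower]) (rule exI)
  then have "surj (\<lambda>y. H 0 y - wt 0 *s y)"
    by (simp add: surj_def)
  moreover have lin: "linop (\<lambda>y. H 0 y - wt 0 *s y)"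
    by unfold_locales (simp_all add: H_linear scale_right_distrib scale_right_diff_distrib mult.commute)
  ultimately have "inj (\<lambda>y. H 0 y - wt 0 *s y)"
    by (intro linear_surj_imp_inj)
  then have "v = 0"
    using H_v[of 0] unfolding module_hom.inj_iff_eq_0[OF module_hom_linearI[OF lin]] by simp
  with v show False ..
qed


lemma ex_dual_vector:
  obtains g where "Vector_Spaces.linear scale (*) g" "g v = 1" "\<And>x. x \<in> lower \<Longrightarrow> g x = 0"
proof -
  interpret P: vector_space_pair scale "(*) :: 'f \<Rightarrow> 'f \<Rightarrow> 'f"
    by unfold_locales (simp_all add: algebra_simps)
  obtain B where B: "B \<subseteq> lower" "independent B" "lower \<subseteq> span B"
    by (rule maximal_independent_subset)
  have "span B \<subseteq> lower"
    using B(1) subspace_lower by (rule span_minimal)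
  then have "v \<notin> span B" using v_notin_lower by blast
  then have "independent (insert v B)" using B(2) by (rule independent_insertI)
  from P.linear_independent_extend[OF this, of "\<lambda>x. if x = v then 1 else 0"]
  obtain g where g: "Vector_Spaces.linear scale (*) g" "\<forall>x\<in>insert v B. g x = (if x = v then 1 else 0)"
    by blast
  interpret g: Vector_Spaces.linear scale "(*)" g by (rule g)
  have "subspace {x. g x = 0}"
    by (intro subspaceI) (simp_all add: g.add g.scale)
  moreover have "B \<subseteq> {x. g x = 0}"
    using g(2) \<open>v \<notin> span B\<close> by (auto intro: span_base)
  ultimately have "span B \<subseteq> {x. g x = 0}"
    by (intro span_minimal)
  then show ?thesis
    using that[OF g(1)] g(2) B(3) by auto
qed

section \<open>Linear functionals and bilinear forms\<close>

lemma linear_functionalI: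
  assumes "\<And>x y. f (x + y) = f x + f y" "\<And>c x. f (c *s x) = c * f x"
  shows "Vector_Spaces.linear scale (*) f"
  by unfold_locales (simp_all add: assms algebra_simps)

lemma linear_functional:
  assumes "Vector_Spaces.linear scale (*) f"
  shows "f (x + y) = f x + f y" "f (c *s x) = c * f x" "f 0 = 0" "f (x - y) = f x - f y" "f (- x) = - f x"
proof -
  interpret f: Vector_Spaces.linear scale "(*)" f by (rule assms)
  show "f (x + y) = f x + f y" "f (c *s x) = c * f x" "f 0 = 0" "f (x - y) = f x - f y" "f (- x) = - f x"
    by (rule f.add f.scale f.zero f.diff f.neg)+
qed

lemma bilinear_formI:
  assumes "\<And>x y u. b (x + y) u = b x u + b y u" "\<And>c x u. b (c *s x) u = c * b x u"
    and "\<And>x y u. b u (x + y) = b u x + b u y" "\<And>c x u. b u (c *s x) = c * b u x"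
  shows "bilinear_form scale b"
  unfolding bilinear_form_def by (intro conjI allI linear_functionalI assms)

lemma bilinear_left:
  assumes "bilinear_form scale b"
  shows "b (x + y) u = b x u + b y u" "b (c *s x) u = c * b x u" "b 0 u = 0"
    "b (x - y) u = b x u - b y u" "b (- x) u = - b x u"
proof -
  have "Vector_Spaces.linear scale (*) (\<lambda>x. b x u)"
    using assms by (simp add: bilinear_form_def)
  from linear_functional[OF this]
  show "b (x + y) u = b x u + b y u" "b (c *s x) u = c * b x u" "b 0 u = 0"
    "b (x - y) u = b x u - b y u" "b (- x) u = - b x u" .
qed

lemma bilinear_right:
  assumes "bilinear_form scale b"
  shows "b u (x + y) = b u x + b u y" "b u (c *s x) = c * b u x" "b u 0 = 0"
    "b u (x - y) = b u x - b u y" "b u (- x) = - b u x"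
proof -
  have "Vector_Spaces.linear scale (*) (b u)"
    using assms by (simp add: bilinear_form_def)
  from linear_functional[OF this]
  show "b u (x + y) = b u x + b u y" "b u (c *s x) = c * b u x" "b u 0 = 0"
    "b u (x - y) = b u x - b u y" "b u (- x) = - b u x" .
qed

text \<open>The coefficient of \<open>v\<close> in the decomposition along \<open>lower\<close>; it
  is the highest weight vector of the twisted dual.\<close>

definition top_coeff :: "'v \<Rightarrow> 'f"
  where "top_coeff = (SOME g. Vector_Spaces.linear scale (*) g \<and> g v = 1 \<and> (\<forall>x\<in>lower. g x = 0))"

lemma top_coeff: "Vector_Spaces.linear scale (*) top_coeff" "top_coeff v = 1"
  "x \<in> lower \<Longrightarrow> top_coeff x = 0"
proof -
  have "\<exists>g. Vector_Spaces.linear scale (*) g \<and> g v = 1 \<and> (\<forall>x\<in>lower. g x = 0)"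
    by (rule ex_dual_vector) blast
  from someI_ex[OF this, folded top_coeff_def]
  show "Vector_Spaces.linear scale (*) top_coeff" "top_coeff v = 1" "x \<in> lower \<Longrightarrow> top_coeff x = 0"
    by blast+
qed

lemmas top_coeff_linear = linear_functional[OF top_coeff(1)]

text \<open>The \<open>H n\<close> preserve \<open>lower\<close>. In the twisted dual, where
  \<open>H n\<close> acts by precomposition, \<open>top_coeff\<close> thus has the same weights as
  \<open>v\<close>.\<close>

lemma top_coeff_H: "top_coeff (H n x) = wt n * top_coeff x"
proof -
  obtain c w where w: "w \<in> lower" "x = c *s v + w" by (rule decompose)
  have "H n w \<in> lower"
    using w(1)
  proof (induction rule: lower_induct)
    case 1
    show ?case
      using subspace_lower
      by (intro subspaceI) (simp_all add: H_linear subspace_0 subspace_add subspace_scale)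
  next
    case (2 m y)
    show ?case
      using subspace_lower by (simp add: H_F F_in_lower subspace_diff subspace_scale)
  qed
  then show ?thesis
    using w by (simp add: H_linear top_coeff_linear top_coeff(2,3) H_v)
qed

text \<open>
  The submodule generated by \<open>(v, top_coeff)\<close> in the direct sum of the module and its twisted
  dual. It turns out to be the graph of the linear map given by the form.
\<close>

inductive graph :: "'v \<Rightarrow> ('v \<Rightarrow> 'f) \<Rightarrow> bool" where
  graph_base: "graph v top_coeff"
| graph_F: "graph x f \<Longrightarrow> graph (F n x) (\<lambda>u. f ((- 1 / 4) *s E (n + 1) u))"
| graph_add: "graph x f \<Longrightarrow> graph x' f' \<Longrightarrow> graph (x + x') (\<lambda>u. f u + f' u)"
| graph_scale: "graph x f \<Longrightarrow> graph (c *s x) (\<lambda>u. c * f u)"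

lemma graph_linear: "graph x f \<Longrightarrow> Vector_Spaces.linear scale (*) f"
proof (induction rule: graph.induct)
  case graph_base
  show ?case by (rule top_coeff)
next
  case (graph_F x f n)
  show ?case
    by (rule linear_functionalI)
      (simp_all only: linop_add[OF linop_E] linop_scale[OF linop_E] linear_functional[OF graph_F.IH]
        scale_right_distrib distrib_left mult.left_commute)
next
  case (graph_add x f x' f')
  show ?case
    by (rule linear_functionalI)
      (simp_all add: linear_functional[OF graph_add.IH(1)] linear_functional[OF graph_add.IH(2)] algebra_simps)
next
  case (graph_scale x f c)
  show ?case
    by (rule linear_functionalI) (simp_all add: linear_functional[OF graph_scale.IH] algebra_simps)
qed

lemmas graph_functional = linear_functional[OF graph_linear]

lemma graph_cong: "graph x f \<Longrightarrow> x = x' \<Longrightarrow> (\<And>u. f u = f' u) \<Longrightarrow> graph x' f'"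
  by (metis ext)

lemma graph_0: "graph 0 (\<lambda>u. 0)"
  using graph_scale[OF graph_base, of 0] by simp

text \<open>The relation is generated under the \<open>F n\<close> only. Closure under
  \<open>H n\<close> follows by commuting it past each \<open>F m\<close> down to the base pair,
  which it scales by \<open>wt n\<close>.\<close>

lemma graph_H: "graph x f \<Longrightarrow> graph (H n x) (\<lambda>u. f (H n u))"
proof (induction arbitrary: n rule: graph.induct)
  case graph_base
  show ?case
    by (rule graph_cong[OF graph_scale[OF graph.graph_base, of "wt n"]]) (simp_all add: H_v top_coeff_H)
next
  case (graph_F x f m)
  show ?case
    by (rule graph_cong[OF graph_add[OF graph.graph_F[OF graph_F.IH[of n], of m]
            graph_scale[OF graph.graph_F[OF graph_F.hyps, of "n + m"], of "- 2"]]])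
      (simp_all add: H_F H_E H_linear E_linear graph_functional[OF graph_F.hyps] algebra_simps)
next
  case (graph_add x f x' f')
  show ?case
    by (rule graph_cong[OF graph.graph_add[OF graph_add.IH(1)[of n] graph_add.IH(2)[of n]]])
      (simp_all add: H_linear)
next
  case (graph_scale x f c)
  show ?case
    by (rule graph_cong[OF graph.graph_scale[OF graph_scale.IH[of n], of c]]) (simp_all add: H_linear)
qed

text \<open>The same commutation argument; at the base pair both entries become zero, since
  \<open>E n\<close> kills \<open>v\<close> and \<open>top_coeff\<close> vanishes on the image of
  \<open>F (n - 1)\<close>.\<close>

lemma graph_E: "graph x f \<Longrightarrow> graph (E n x) (\<lambda>u. f (- (4 *s F (n - 1) u)))"
proof (induction arbitrary: n rule: graph.induct)
  case graph_base
  show ?case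
    by (rule graph_cong[OF graph_0])
      (simp_all add: E_v top_coeff_linear top_coeff(3) F_in_lower)
next
  case (graph_F x f m)
  show ?case
    by (rule graph_cong[OF graph_add[OF graph.graph_F[OF graph_F.IH[of n], of m]
            graph_H[OF graph_F.hyps, of "n + m"]]])
      (simp_all add: E_F E_linear F_linear graph_functional[OF graph_F.hyps] algebra_simps)
next
  case (graph_add x f x' f')
  show ?case
    by (rule graph_cong[OF graph.graph_add[OF graph_add.IH(1)[of n] graph_add.IH(2)[of n]]])
      (simp_all add: E_linear)
next
  case (graph_scale x f c)
  show ?case
    by (rule graph_cong[OF graph.graph_scale[OF graph_scale.IH[of n], of c]]) (simp_all add: E_linear)
qed

text \<open>Here \<open>Q\<close> says that applying \<open>A\<close> to the vector and precomposing
  the functional with \<open>A'\<close> preserves the relation. Precomposition reverses products, in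
  accordance with the reversed bracket in the induction.\<close>

lemma graph_act:
  assumes "graph x f"
  shows "graph (act \<xi> x) (\<lambda>u. - f (act (tet_perm \<sigma> \<xi>) u))"
proof -
  define Q where "Q A A' \<longleftrightarrow> (\<forall>x f. graph x f \<longrightarrow> graph (A x) (\<lambda>u. f (A' u)))"
    for A A' :: "'v \<Rightarrow> 'v"
  have "Q (act \<xi>) (act (- tet_perm \<sigma> \<xi>))"
  proof (rule act_adjoint_induct)
    show "Q (E n) (- op_scale 4 (F (n - 1)))" "Q (F n) (op_scale (- 1 / 4) (E (n + 1)))" "Q (H n) (H n)" for n
      using graph_E graph_F graph_H by (simp_all add: Q_def op_scale_def)
    show "Q (A + B) (A' + B')" if "Q A A'" "Q B B'" for A A' B B'
      unfolding Q_def
    proof (intro allI impI)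
      fix x f assume xf: "graph x f"
      show "graph ((A + B) x) (\<lambda>u. f ((A' + B') u))"
        using graph_add that xf by (simp add: Q_def graph_functional[OF xf])
    qed
    show "Q (op_scale c A) (op_scale c A')" if "Q A A'" for A A' c
      unfolding Q_def
    proof (intro allI impI)
      fix x f assume xf: "graph x f"
      show "graph (op_scale c A x) (\<lambda>u. f (op_scale c A' u))"
        using graph_scale that xf by (simp add: Q_def graph_functional[OF xf] op_scale_def)
    qed
    show "Q (act (tet_bracket x y)) (act (tet_bracket y' x'))"
      if "Q (act x) (act x')" "Q (act y) (act y')" for x x' y y'
      unfolding Q_def
    proof (intro allI impI)
      fix z f assume zf: "graph z f"
      have "graph (act x (act y z)) (\<lambda>u. f (act y' (act x' u)))"
        "graph (act y (act x z)) (\<lambda>u. f (act x' (act y' u)))"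
        using that zf unfolding Q_def by blast+
      from graph_cong[OF graph_add[OF this(1) graph_scale[OF this(2), of "- 1"]]]
      show "graph (act (tet_bracket x y) z) (\<lambda>u. f (act (tet_bracket y' x') u))"
        by (simp add: act_bracket graph_functional[OF zf])
    qed
  qed
  then have "graph (act \<xi> x) (\<lambda>u. f (act (- tet_perm \<sigma> \<xi>) u))"
    using assms by (simp add: Q_def)
  moreover have "act (- z) u = - act z u" for z u
    using act_scale_left[of "-1" z u] by simp
  ultimately show ?thesis by (simp add: graph_functional[OF assms])
qed

text \<open>After a step with \<open>F n\<close> both sides vanish: \<open>E (n + 1)\<close> kills
  \<open>v\<close>, and \<open>F n x\<close> lies in \<open>lower\<close>.\<close>

lemma graph_top: "graph x f \<Longrightarrow> f v = top_coeff x"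
proof (induction rule: graph.induct)
  case (graph_F x f n)
  show ?case by (simp add: E_v graph_functional[OF graph_F.hyps] top_coeff(3) F_in_lower)
qed (simp_all add: top_coeff_linear)

lemma submodule_actI:
  assumes "subspace W" "\<And>\<xi> x. x \<in> W \<Longrightarrow> act \<xi> x \<in> W"
  shows "submodule W"
  using assms by (simp add: submodule_def)

text \<open>The common zeros of all functionals related to 0 form a submodule, and
  \<open>graph_top\<close> places \<open>v\<close> in it, so irreducibility makes it everything.
  Invariance under \<open>\<xi>\<close> comes from \<open>graph_act\<close> at the image of
  \<open>\<xi>\<close> under the involution.\<close>

lemma graph_0_eq:
  assumes "graph 0 f"
  shows "f u = 0"
proof -
  define K where "K = {u. \<forall>f. graph 0 f \<longrightarrow> f u = 0}"
  have "submodule K"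
  proof (rule submodule_actI)
    show "subspace K"
      by (intro subspaceI) (auto simp: K_def graph_functional)
    show "act \<xi> x \<in> K" if "x \<in> K" for \<xi> x
    proof -
      have "f (act \<xi> x) = 0" if "graph 0 f" for f
      proof -
        have "graph 0 (\<lambda>u. - f (act \<xi> u))"
          using graph_act[OF that, of "tet_perm \<sigma> \<xi>"] act_scale_right[of "tet_perm \<sigma> \<xi>" 0 0]
          by (simp add: tet_perm_involution)
        with \<open>x \<in> K\<close> show ?thesis by (force simp: K_def)
      qed
      then show ?thesis by (simp add: K_def)
    qed
  qed
  moreover have "v \<in> K"
    by (simp add: K_def graph_top[of 0] top_coeff_linear)
  ultimately have "K = UNIV"
    using v by (rule submodule_eq_UNIV)
  then show ?thesis using assms by (auto simp: K_def)
qed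

lemma graph_unique:
  assumes "graph x f" "graph x f'"
  shows "f = f'"
proof
  fix u
  have "graph 0 (\<lambda>u. f u + - 1 * f' u)"
    using graph_add[OF assms(1) graph_scale[OF assms(2), of "- 1"]] by simp
  from graph_0_eq[OF this, of u] show "f u = f' u" by simp
qed

lemma graph_total: "\<exists>f. graph x f"
proof -
  have "submodule {x. \<exists>f. graph x f}"
  proof (rule submodule_actI)
    show "subspace {x. \<exists>f. graph x f}"
      by (intro subspaceI) (use graph_0 graph_add graph_scale in blast)+
    show "act \<xi> x \<in> {x. \<exists>f. graph x f}" if "x \<in> {x. \<exists>f. graph x f}" for \<xi> x
      using that graph_act by blast
  qed
  from submodule_eq_UNIV[OF this _ v] show ?thesis
    using graph_base by blast
qed

section \<open>The form, its uniqueness, symmetry and nondegeneracy\<close>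

definition form :: "'v \<Rightarrow> 'v \<Rightarrow> 'f"
  where "form x = (THE f. graph x f)"

lemma graph_form: "graph x (form x)"
  unfolding form_def using graph_total graph_unique by (metis theI)

lemma form_eq: "graph x f \<Longrightarrow> form x u = f u"
  using graph_unique[OF graph_form] by metis

lemma form_v_v: "form v v = 1"
  using form_eq[OF graph_base, of v] by (simp add: top_coeff(2))

lemma bilinear_form_form: "bilinear_form scale form"
  unfolding bilinear_form_def
proof (intro conjI allI)
  show "Vector_Spaces.linear scale (*) (form u)" for u
    by (rule graph_linear[OF graph_form])
  show "Vector_Spaces.linear scale (*) (\<lambda>u. form u w)" for w
    by (rule linear_functionalI)
      (simp_all add: form_eq[OF graph_add[OF graph_form graph_form]] form_eq[OF graph_scale[OF graph_form]] algebra_simps)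
qed

lemma form_act: "form (act \<xi> u) w = - form u (act (tet_perm \<sigma> \<xi>) w)"
  using form_eq[OF graph_act[OF graph_form]] .

lemma form_twisted: "nonzero_twisted_form \<sigma> scale act form"
  unfolding nonzero_twisted_form_def
  using bilinear_form_form form_act form_v_v by (metis zero_neq_one)

text \<open>As \<open>\<sigma>\<close> negates \<open>x_ij\<close>, the operator \<open>H 0\<close>
  is self-adjoint for \<open>b\<close>. So \<open>v\<close> is orthogonal to the image of
  \<open>H 0 - wt 0\<close>, which contains \<open>lower\<close>, and the left radical is a
  submodule containing \<open>v\<close>.\<close>

lemma twisted_form_eq_0:
  assumes b: "bilinear_form scale b" "\<And>\<xi> u w. b (act \<xi> u) w = - b u (act (tet_perm \<sigma> \<xi>) w)"
    and bv: "b v v = 0"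
  shows "b u w = 0"
proof -
  note bl = bilinear_left[OF b(1)] bilinear_right[OF b(1)]
  have "tet_perm \<sigma> (tet_gen i j :: 'f tetrahedron_algebra) = - tet_gen i j"
    using tet_gen_skew[of i j, where 'a = 'f] by (simp add: tet_perm_gen \<sigma> eq_neg_iff_add_eq_0 add.commute)
  then have "act (tet_perm \<sigma> (tet_gen i j)) x = - H 0 x" for x
    using act_scale_left[of "-1" "tet_gen i j" x] by (simp add: T.H_0 T.h_def)
  then have H: "b (H 0 x) y = b x (H 0 y)" for x y
    using b(2)[of "tet_gen i j" x y] by (simp add: T.H_0 T.h_def bl)
  have "b v y = 0" for y
  proof -
    obtain c w where w: "w \<in> lower" "y = c *s v + w" by (rule decompose)
    obtain z where "w = H 0 z - wt 0 *s z" using w(1) by (rule shifted_range)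
    then have "b v w = 0"
      using H[of v z] by (simp add: bl H_v)
    then show ?thesis by (simp add: w bl bv)
  qed
  moreover have "submodule {u. \<forall>w. b u w = 0}"
    by (rule submodule_actI, rule subspaceI) (simp_all add: bl b(2))
  ultimately have "{u. \<forall>w. b u w = 0} = UNIV"
    by (intro submodule_eq_UNIV[OF _ _ v]) simp_all
  then show ?thesis by auto
qed

lemma twisted_form_eq_scaled:
  assumes "bilinear_form scale b" "\<And>\<xi> u w. b (act \<xi> u) w = - b u (act (tet_perm \<sigma> \<xi>) w)"
  shows "b u w = b v v * form u w"
proof -
  define b' where "b' u w = b u w - b v v * form u w" for u w
  have "bilinear_form scale b'"
    by (rule bilinear_formI)
      (simp_all add: b'_def bilinear_left[OF assms(1)] bilinear_right[OF assms(1)]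
        bilinear_left[OF bilinear_form_form] bilinear_right[OF bilinear_form_form] algebra_simps)
  then have "b' u w = 0"
    by (rule twisted_form_eq_0) (simp_all add: b'_def assms(2) form_act form_v_v)
  then show ?thesis by (simp add: b'_def)
qed

text \<open>The transposed form has the same invariance because \<open>\<sigma>\<close> is an
  involution. It is therefore a multiple of \<open>form\<close>, and the value 1 at
  \<open>(v, v)\<close> makes the factor 1.\<close>

lemma symmetric_form: "symmetric_form form"
proof -
  have "form w u = form v v * form u w" for u w
  proof (rule twisted_form_eq_scaled)
    show "bilinear_form scale (\<lambda>u w. form w u)"
      using bilinear_form_form by (simp add: bilinear_form_def)
    show "form w (act \<xi> u) = - form (act (tet_perm \<sigma> \<xi>) w) u" for \<xi> u w
      by (simp add: form_act tet_perm_involution)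
  qed
  then show ?thesis by (simp add: symmetric_form_def form_v_v)
qed

text \<open>The left radical is a submodule that misses \<open>v\<close>, hence zero; symmetry
  settles the right one.\<close>

lemma nondegenerate_form: "nondegenerate_form form"
proof -
  have "u = 0" if "\<forall>w. form u w = 0" for u
  proof (rule ccontr)
    assume "u \<noteq> 0"
    moreover have "submodule {u. \<forall>w. form u w = 0}"
      by (rule submodule_actI, rule subspaceI) (simp_all add: bilinear_left[OF bilinear_form_form] form_act)
    ultimately have "{u. \<forall>w. form u w = 0} = UNIV"
      by (intro submodule_eq_UNIV[of _ u]) (simp_all add: that)
    then have "form v v = 0" by auto
    then show False by (simp add: form_v_v)
  qed
  with symmetric_form show ?thesis
    unfolding nondegenerate_form_def symmetric_form_def by metis
qed

lemma twisted_form_iff: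
  "nonzero_twisted_form \<sigma> scale act b \<longleftrightarrow> (\<exists>c. c \<noteq> 0 \<and> b = (\<lambda>u w. c * form u w))"
proof
  assume b: "nonzero_twisted_form \<sigma> scale act b"
  then have "b u w = b v v * form u w" for u w
    unfolding nonzero_twisted_form_def by (intro twisted_form_eq_scaled) auto
  moreover from this have "b v v \<noteq> 0"
    using b unfolding nonzero_twisted_form_def by (metis mult_zero_left)
  ultimately show "\<exists>c. c \<noteq> 0 \<and> b = (\<lambda>u w. c * form u w)" by blast
next
  assume "\<exists>c. c \<noteq> 0 \<and> b = (\<lambda>u w. c * form u w)"
  then obtain c where c: "c \<noteq> 0" "b = (\<lambda>u w. c * form u w)" by blast
  have "bilinear_form scale b"
    by (rule bilinear_formI)
      (simp_all add: c(2) bilinear_left[OF bilinear_form_form] bilinear_right[OF bilinear_form_form] algebra_simps)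
  moreover have "b v v \<noteq> 0" by (simp add: c form_v_v)
  ultimately show "nonzero_twisted_form \<sigma> scale act b"
    unfolding nonzero_twisted_form_def by (auto simp: c form_act)
qed

end

lemma klein_four_cases:
  assumes "\<sigma> \<in> klein_four" "\<sigma> \<noteq> 1"
  obtains i j k l where "distinct [i, j, k, l]"
    "Perm.apply \<sigma> i = j" "Perm.apply \<sigma> j = i" "Perm.apply \<sigma> k = l" "Perm.apply \<sigma> l = k"
proof -
  consider "\<sigma> = Perm.swap 0 1 * Perm.swap 2 3" | "\<sigma> = Perm.swap 0 2 * Perm.swap 1 3"
    | "\<sigma> = Perm.swap 0 3 * Perm.swap 1 2"
    using assms by (auto simp: klein_four_def)
  then show ?thesis
  proof cases
    case 1
    show ?thesis by (rule that[of 0 1 2 3]) (simp_all add: 1 apply_times)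
  next
    case 2
    show ?thesis by (rule that[of 0 2 1 3]) (simp_all add: 2 apply_times)
  next
    case 3
    show ?thesis by (rule that[of 0 3 1 2]) (simp_all add: 3 apply_times)
  qed
qed

theorem theorem19p1:
  fixes scale :: "'f::{alg_closed_field, field_char_0} \<Rightarrow> 'v::ab_group_add \<Rightarrow> 'v"
    and act :: "'f tetrahedron_algebra \<Rightarrow> 'v \<Rightarrow> 'v"
    and \<sigma> :: "4 perm"
  assumes "lie_module tet_scale tet_bracket scale act"
    and "lie_module.finite_dimensional_module scale"
    and "lie_module.irreducible_module scale act"
    and "\<sigma> \<in> klein_four" and "\<sigma> \<noteq> 1"
  shows "\<exists>b. nonzero_twisted_form \<sigma> scale act b
           \<and> (\<forall>b'. nonzero_twisted_form \<sigma> scale act b' \<longleftrightarrow> (\<exists>c. c \<noteq> 0 \<and> b' = (\<lambda>u v. c * b u v)))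
           \<and> nondegenerate_form b \<and> symmetric_form b"
proof -
  interpret M: lie_module tet_scale tet_bracket scale act by fact
  obtain B where "finite B" "M.span B = UNIV"
    using assms(2) unfolding M.finite_dimensional_module_def by blast
  moreover obtain Basis where "Basis \<subseteq> B" "M.independent Basis" "B \<subseteq> M.span Basis"
    by (rule M.maximal_independent_subset)
  ultimately have Basis: "finite Basis" "M.independent Basis" "M.span Basis = UNIV"
    using M.span_minimal[of B "M.span Basis"] by (auto intro: finite_subset)
  obtain i j k l where ijkl: "distinct [i, j, k, l]"
    "Perm.apply \<sigma> i = j" "Perm.apply \<sigma> j = i" "Perm.apply \<sigma> k = l" "Perm.apply \<sigma> l = k"
    using assms(4,5) by (rule klein_four_cases)
  interpret M: tetrahedron_module scale Basis act i j k l \<sigma>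
    by unfold_locales (use Basis ijkl assms(3) in auto)
  obtain v wt where "v \<noteq> 0" "\<And>n. M.E n v = 0" "\<And>n. M.H n v = scale (wt n) v"
    "\<And>w. M.H 0 w = scale (wt 0 + 2) w \<Longrightarrow> w = 0"
    by (rule M.ex_highest_weight_vector) blast
  then interpret M: highest_weight_module scale Basis act i j k l \<sigma> v wt
    by unfold_locales
  show ?thesis
    using M.form_twisted M.twisted_form_iff M.nondegenerate_form M.symmetric_form by blast
qed

end
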